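(* Let $L$ be a compact LOTS which does not contain a Cantor subset, and let $S$ be a compact Hausdorff scattered space. Then the product space $L \times S$ has the Complex Stone-Weierstrass Property (CSWP).
   Context: A LOTS is a linearly ordered set with its order topology. A Cantor subset of a space is a subspace homeomorphic to the Cantor set. A space is scattered iff every non-empty subset has a (relatively) isolated point. For a compact Hausdorff space $X$, $C(X)=C(X,\mathbb{C})$ is the algebra of continuous complex-valued functions on $X$ with the supremum norm. A compact Hausdorff space $X$ has the CSWP iff every complex subalgebra $\mathcal{A}\subseteq C(X)$ which separates the points of $X$ and contains the constant functions is dense in $C(X)$. *)

theory Defs
  imports "HOL-Analysis.Analysis"
begin

text \<open>The Cantor set, up to homeomorphism: the countable power of the two-point discrete space.\<close>

definition Cantor_space :: "(nat \<Rightarrow> bool) topology" where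
  "Cantor_space = product_topology (\<lambda>_. discrete_topology UNIV) UNIV"

definition Cantor_subset_of :: "'a topology \<Rightarrow> 'a set \<Rightarrow> bool" where
  "Cantor_subset_of X K \<longleftrightarrow>
     K \<subseteq> topspace X \<and> subtopology X K homeomorphic_space Cantor_space"

definition scattered_space :: "'a topology \<Rightarrow> bool" where
  "scattered_space X \<longleftrightarrow>
     (\<forall>A. A \<subseteq> topspace X \<and> A \<noteq> {} \<longrightarrow> (\<exists>x\<in>A. openin (subtopology X A) {x}))"

text \<open>
  \<open>C(X)\<close> with the supremum metric, as the library's metric space of bounded continuous functions;
  boundedness is automatic for compact \<open>X\<close>. Its elements are extensional, i.e. fixed
  to \<open>undefined\<close> outside \<open>topspace X\<close>, so the algebra operations below are
  restricted to \<open>topspace X\<close>.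
\<close>

abbreviation C_metric :: "'a topology \<Rightarrow> ('a \<Rightarrow> complex) metric" where
  "C_metric X \<equiv> cfunspace X euclidean_metric"

definition complex_subalgebra :: "'a topology \<Rightarrow> ('a \<Rightarrow> complex) set \<Rightarrow> bool" where
  "complex_subalgebra X A \<longleftrightarrow>
     A \<subseteq> mspace (C_metric X) \<and> A \<noteq> {} \<and>
     (\<forall>f\<in>A. \<forall>g\<in>A. (\<lambda>x\<in>topspace X. f x + g x) \<in> A) \<and>
     (\<forall>f\<in>A. \<forall>g\<in>A. (\<lambda>x\<in>topspace X. f x * g x) \<in> A) \<and>
     (\<forall>c. \<forall>f\<in>A. (\<lambda>x\<in>topspace X. c * f x) \<in> A)"

definition separates_points :: "'a topology \<Rightarrow> ('a \<Rightarrow> complex) set \<Rightarrow> bool" where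
  "separates_points X A \<longleftrightarrow>
     (\<forall>x\<in>topspace X. \<forall>y\<in>topspace X. x \<noteq> y \<longrightarrow> (\<exists>f\<in>A. f x \<noteq> f y))"

definition contains_constants :: "'a topology \<Rightarrow> ('a \<Rightarrow> complex) set \<Rightarrow> bool" where
  "contains_constants X A \<longleftrightarrow> (\<forall>c. (\<lambda>x\<in>topspace X. c) \<in> A)"

definition CSWP :: "'a topology \<Rightarrow> bool" where
  "CSWP X \<longleftrightarrow> compact_space X \<and> Hausdorff_space X \<and>
     (\<forall>A. complex_subalgebra X A \<and> separates_points X A \<and> contains_constants X A \<longrightarrow>
        mtopology_of (C_metric X) closure_of A = mspace (C_metric X))"

end

theory Submission
  imports Defs
begin

text \<open>
  Suppose \<open>f\<close> has positive distance \<open>d\<close> from the algebra \<open>A\<close>. By Zorn's lemma there is a minimal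
  closed set \<open>Y\<close> on which \<open>f\<close> still has distance at least \<open>d\<close> from \<open>A\<close>. Minimality forbids
  approximate idempotents of \<open>A\<close> on \<open>Y\<close> (glue approximations of \<open>f\<close> on the two pieces), and, by averaging
  approximations that are bad only on disjoint open sets, it yields a strong chain condition:
  the projection of \<open>Y\<close> to \<open>L\<close> is essentially separable and hence carries a continuous
  monotone map \<open>p\<close> to the reals with finite fibers.

  Pass to a minimal boundary \<open>B\<close> of \<open>Y\<close>, a minimal closed subset on which all moduli of elements of \<open>A\<close>
  attain their maxima. Since \<open>S\<close> is scattered, \<open>B\<close> has a clopen slice \<open>U \<times> {\<sigma>}\<close>, and some
  \<open>h \<in> A\<close> is larger somewhere on that slice than anywhere off it. The absence of a Cantor set forces uncountably
  many fibers of \<open>p\<close> over \<open>U\<close> to be nontrivial where \<open>h\<close> is large. For each such fiber \<open>t\<close>,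
  multiplication by powers of \<open>h\<close> gives \<open>F t \<in> A\<close> that takes the values 0 and 1 at the ends of the
  fiber and is small off the slice. Two of these functions are so close that \<open>F s - F t\<close> is
  nearly confined to the countably many differences of values of \<open>F t\<close> on single fibers, so
  the real parts of its values split into two separated nonempty sets. Newton's iteration for the
  sign function turns this into an approximate idempotent, a contradiction.
\<close>

section \<open>Approximate idempotents in function algebras\<close>

text \<open>Elements are total functions, so one algebra can be studied on varying subsets of the
  type without restricting its members.\<close>

locale unital_function_algebra =
  fixes A :: "('x \<Rightarrow> complex) set"
  assumes add_closed: "f \<in> A \<Longrightarrow> g \<in> A \<Longrightarrow> (\<lambda>x. f x + g x) \<in> A"
    and mult_closed: "f \<in> A \<Longrightarrow> g \<in> A \<Longrightarrow> (\<lambda>x. f x * g x) \<in> A"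
    and const_closed: "(\<lambda>_. c) \<in> A"
begin

lemma cmult_closed: "f \<in> A \<Longrightarrow> (\<lambda>x. c * f x) \<in> A"
  using mult_closed[OF const_closed] by blast

lemma diff_closed: "f \<in> A \<Longrightarrow> g \<in> A \<Longrightarrow> (\<lambda>x. f x - g x) \<in> A"
  using add_closed[of f "\<lambda>x. (-1) * g x"] cmult_closed[of g "-1"] by simp

lemma power_closed: "f \<in> A \<Longrightarrow> (\<lambda>x. f x ^ n) \<in> A"
  by (induction n) (simp_all add: const_closed mult_closed)

lemma sum_closed: "finite I \<Longrightarrow> (\<And>i. i \<in> I \<Longrightarrow> f i \<in> A) \<Longrightarrow> (\<lambda>x. \<Sum>i\<in>I. f i x) \<in> A"
  by (induction I rule: finite_induct) (simp_all add: const_closed add_closed)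

text \<open>Values off \<open>B\<close> are arbitrary. Inverses and Newton iterates live in this
  closure; only the final result is approximated by an element of \<open>A\<close>.\<close>

definition uniform_closure :: "'x set \<Rightarrow> ('x \<Rightarrow> complex) set" where
  "uniform_closure B = {u. \<forall>e>0. \<exists>a\<in>A. \<forall>b\<in>B. cmod (u b - a b) < e}"

lemma uniform_closureI:
  "(\<And>e. e > 0 \<Longrightarrow> \<exists>a\<in>A. \<forall>b\<in>B. cmod (u b - a b) < e) \<Longrightarrow> u \<in> uniform_closure B"
  by (simp add: uniform_closure_def)

lemma uniform_closureE:
  assumes "u \<in> uniform_closure B" "e > 0"
  obtains a where "a \<in> A" "\<And>b. b \<in> B \<Longrightarrow> cmod (u b - a b) < e"
  using assms by (auto simp: uniform_closure_def)

lemma subset_uniform_closure: "A \<subseteq> uniform_closure B"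
  by (force simp: uniform_closure_def)

lemma uniform_closure_add:
  assumes "u \<in> uniform_closure B" "v \<in> uniform_closure B"
  shows "(\<lambda>x. u x + v x) \<in> uniform_closure B"
proof (rule uniform_closureI)
  fix e :: real assume "e > 0"
  then have e: "e/2 > 0" by simp
  obtain a b where a: "a \<in> A" "\<And>x. x \<in> B \<Longrightarrow> cmod (u x - a x) < e/2"
    and b: "b \<in> A" "\<And>x. x \<in> B \<Longrightarrow> cmod (v x - b x) < e/2"
    using uniform_closureE[OF assms(1) e] uniform_closureE[OF assms(2) e] by metis
  have "cmod (u x + v x - (a x + b x)) < e" if "x \<in> B" for x
    using norm_diff_triangle_ineq[of "u x" "v x" "a x" "b x"] a(2)[OF that] b(2)[OF that] by simp
  then show "\<exists>a\<in>A. \<forall>x\<in>B. cmod (u x + v x - a x) < e"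
    using add_closed[OF a(1) b(1)] by (intro bexI[of _ "\<lambda>x. a x + b x"]) auto
qed

lemma uniform_closure_closed:
  assumes "\<And>e. e > 0 \<Longrightarrow> \<exists>a\<in>uniform_closure B. \<forall>b\<in>B. cmod (u b - a b) \<le> e"
  shows "u \<in> uniform_closure B"
proof (rule uniform_closureI)
  fix e :: real assume "e > 0"
  then have e: "e/2 > 0" by simp
  obtain v where v: "v \<in> uniform_closure B" "\<And>x. x \<in> B \<Longrightarrow> cmod (u x - v x) \<le> e/2"
    using assms[OF e] by blast
  obtain a where a: "a \<in> A" "\<And>x. x \<in> B \<Longrightarrow> cmod (v x - a x) < e/2"
    using uniform_closureE[OF v(1) e] by metis
  have "cmod (u x - a x) < e" if "x \<in> B" for x
    using norm_triangle_ineq[of "u x - v x" "v x - a x"] v(2)[OF that] a(2)[OF that] by simp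
  then show "\<exists>a\<in>A. \<forall>x\<in>B. cmod (u x - a x) < e"
    using a(1) by blast
qed

end

section \<open>Products and inverses in the uniform closure\<close>

locale bounded_function_algebra = unital_function_algebra A
  for A :: "('x \<Rightarrow> complex) set" +
  fixes B :: "'x set"
  assumes bounded_on: "f \<in> A \<Longrightarrow> bounded (f ` B)"
begin

abbreviation UC where "UC \<equiv> uniform_closure B"

lemma uniform_closure_bounded:
  assumes "u \<in> UC" obtains M where "M > 0" "\<And>x. x \<in> B \<Longrightarrow> cmod (u x) \<le> M"
proof -
  obtain a where a: "a \<in> A" "\<And>x. x \<in> B \<Longrightarrow> cmod (u x - a x) < 1"
    using uniform_closureE[OF assms, of 1] by auto
  obtain M where M: "\<And>x. x \<in> B \<Longrightarrow> cmod (a x) \<le> M"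
    using bounded_on[OF a(1)] by (auto simp: bounded_iff)
  have "cmod (u x) \<le> max 1 (M + 1)" if "x \<in> B" for x
    using norm_triangle_ineq[of "u x - a x" "a x"] a(2)[OF that] M[OF that] by simp
  then show ?thesis by (intro that[of "max 1 (M+1)"]) auto
qed

lemma uniform_closure_mult:
  assumes "u \<in> UC" "v \<in> UC"
  shows "(\<lambda>x. u x * v x) \<in> UC"
proof (rule uniform_closureI)
  fix e :: real assume e: "e > 0"
  obtain M where M: "M > 0" "\<And>x. x \<in> B \<Longrightarrow> cmod (u x) \<le> M"
    using uniform_closure_bounded[OF assms(1)] by blast
  \<comment> \<open>\<open>b\<close> is fixed before \<open>a\<close>, because the accuracy demanded
    of \<open>a\<close> depends on the bound \<open>N\<close> for \<open>b\<close>.\<close>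
  obtain b where b: "b \<in> A" "\<And>x. x \<in> B \<Longrightarrow> cmod (v x - b x) < e / (2*M)"
    using uniform_closureE[OF assms(2), of "e / (2*M)"] e M(1) by auto
  obtain N where N: "N > 0" "\<And>x. x \<in> B \<Longrightarrow> cmod (b x) \<le> N"
    using uniform_closure_bounded[of b] b(1) subset_uniform_closure by blast
  obtain a where a: "a \<in> A" "\<And>x. x \<in> B \<Longrightarrow> cmod (u x - a x) < e / (2*N)"
    using uniform_closureE[OF assms(1), of "e / (2*N)"] e N(1) by auto
  have "cmod (u x * v x - a x * b x) < e" if "x \<in> B" for x
  proof -
    have "cmod (u x * v x - a x * b x) = cmod (u x * (v x - b x) + (u x - a x) * b x)"
      by (simp add: algebra_simps)
    also have "\<dots> \<le> cmod (u x) * cmod (v x - b x) + cmod (u x - a x) * cmod (b x)"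
      by (metis norm_mult norm_triangle_ineq)
    also have "\<dots> \<le> M * cmod (v x - b x) + cmod (u x - a x) * N"
      using M(1) M(2)[OF that] N(2)[OF that] by (intro add_mono mult_mono) auto
    also have "\<dots> < M * (e / (2*M)) + e / (2*N) * N"
      using M(1) N(1) a(2)[OF that] b(2)[OF that]
      by (intro add_strict_mono mult_strict_left_mono mult_strict_right_mono) auto
    also have "\<dots> = e" using M(1) N(1) by simp
    finally show ?thesis .
  qed
  then show "\<exists>a\<in>A. \<forall>x\<in>B. cmod (u x * v x - a x) < e"
    using mult_closed[OF a(1) b(1)] by (intro bexI[of _ "\<lambda>x. a x * b x"]) auto
qed

lemma const_uniform_closure: "(\<lambda>_. c) \<in> UC"
  using const_closed subset_uniform_closure by blast

lemma uniform_closure_cmult: "u \<in> UC \<Longrightarrow> (\<lambda>x. c * u x) \<in> UC"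
  using uniform_closure_mult[OF const_uniform_closure] by blast

lemma uniform_closure_diff: "u \<in> UC \<Longrightarrow> v \<in> UC \<Longrightarrow> (\<lambda>x. u x - v x) \<in> UC"
  using uniform_closure_add[of u B "\<lambda>x. (-1) * v x"] uniform_closure_cmult[of v "-1"] by simp

lemma uniform_closure_power: "u \<in> UC \<Longrightarrow> (\<lambda>x. u x ^ n) \<in> UC"
  by (induction n) (simp_all add: const_uniform_closure uniform_closure_mult)

lemma uniform_closure_sum:
  "finite I \<Longrightarrow> (\<And>i. i \<in> I \<Longrightarrow> u i \<in> UC) \<Longrightarrow> (\<lambda>x. \<Sum>i\<in>I. u i x) \<in> UC"
  by (induction I rule: finite_induct) (simp_all add: const_uniform_closure uniform_closure_add)

text \<open>\<open>q\<close> is an approximate inverse of \<open>u\<close>. The Neumann series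
  \<open>q * (\<Sum>k. (1 - q * u) ^ k)\<close> converges to \<open>1 / u\<close> uniformly on
  \<open>B\<close>, since its ratio is at most 1/2 there.\<close>

lemma uniform_closure_inverse_Neumann:
  assumes q: "q \<in> UC" and u: "u \<in> UC" and le: "\<And>x. x \<in> B \<Longrightarrow> cmod (1 - q x * u x) \<le> 1/2"
  shows "(\<lambda>x. 1 / u x) \<in> UC"
proof (rule uniform_closure_closed)
  fix e :: real assume e: "e > 0"
  obtain Q where Q: "Q > 0" "\<And>x. x \<in> B \<Longrightarrow> cmod (q x) \<le> Q"
    using uniform_closure_bounded[OF q] by blast
  \<comment> \<open>The remainder after \<open>n\<close> terms is
    \<open>(1 - q * u) ^ n / u\<close>, and \<open>1 / cmod (u x)\<close> is at most
    \<open>2 * Q\<close>.\<close>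
  obtain n where n: "(1/2::real) ^ n < e / (2*Q)"
    using real_arch_pow_inv[of "e / (2*Q)" "1/2"] e Q(1) by auto
  define s where "s x = q x * (\<Sum>k<n. (1 - q x * u x) ^ k)" for x
  have "s \<in> UC"
    unfolding s_def
    by (intro uniform_closure_mult[OF q] uniform_closure_sum uniform_closure_power
        uniform_closure_diff const_uniform_closure u q) auto
  moreover have "cmod (1 / u x - s x) \<le> e" if x: "x \<in> B" for x
  proof -
    have h: "cmod (q x * u x) \<ge> 1/2"
      using le[OF x] norm_triangle_ineq2[of 1 "1 - q x * u x"] by simp
    then have nz: "q x \<noteq> 0" "u x \<noteq> 0" by auto
    have "(q x * u x) * (\<Sum>k<n. (1 - q x * u x) ^ k) = 1 - (1 - q x * u x) ^ n"
      using one_diff_power_eq[of "1 - q x * u x" n] by simp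
    then have "s x * u x = 1 - (1 - q x * u x) ^ n"
      by (simp add: s_def mult_ac)
    then have eq: "1 / u x - s x = (1 - q x * u x) ^ n / u x"
      using nz by (simp add: field_simps)
    have "1 / cmod (u x) \<le> 2 * Q"
    proof -
      have "1/2 \<le> cmod (q x) * cmod (u x)" using h by (simp add: norm_mult)
      also have "\<dots> \<le> Q * cmod (u x)" using Q(2)[OF x] by (intro mult_right_mono) auto
      finally show ?thesis using nz by (simp add: field_simps)
    qed
    then have "cmod (1 / u x - s x) \<le> (1/2)^n * (2 * Q)"
      using power_mono[OF le[OF x], of n] unfolding eq norm_divide norm_power
      by (metis (no_types, lifting) divide_inverse inverse_eq_divide mult_mono norm_ge_zero
          zero_le_divide_1_iff zero_le_power half_gt_zero_iff less_eq_real_def norm_power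
          zero_less_one zero_le_one)
    also have "\<dots> \<le> e" using n Q(1) by (simp add: field_simps)
    finally show ?thesis .
  qed
  ultimately show "\<exists>a\<in>UC. \<forall>b\<in>B. cmod (1 / u b - a b) \<le> e" by blast
qed

text \<open>
  The inverse of \<open>u - i\<tau>\<close> is a Neumann series for large \<open>\<tau>\<close>, and the imaginary axis keeps
  distance \<open>\<eta>\<close> from the values of \<open>u\<close>, so \<open>\<tau>\<close> can be lowered to 0 in steps of \<open>\<eta>/2\<close>.
\<close>

lemma uniform_closure_inverse:
  assumes u: "u \<in> UC" and eta: "\<eta> > 0" "\<And>x. x \<in> B \<Longrightarrow> \<bar>Re (u x)\<bar> \<ge> \<eta>"
  shows "(\<lambda>x. 1 / u x) \<in> UC"
proof -
  obtain M where M: "M > 0" "\<And>x. x \<in> B \<Longrightarrow> cmod (u x) \<le> M"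
    using uniform_closure_bounded[OF u] by blast
  define P where "P \<tau> \<longleftrightarrow> (\<lambda>x. 1 / (u x - \<i> * of_real \<tau>)) \<in> UC" for \<tau> :: real
  have sub: "(\<lambda>x. u x - \<i> * of_real \<tau>) \<in> UC" for \<tau>
    using uniform_closure_diff[OF u const_uniform_closure] by blast
  \<comment> \<open>Here the constant \<open>\<i> / \<tau>\<close> serves as approximate inverse,
    with error \<open>cmod (u x) / \<tau>\<close>.\<close>
  have far: "P \<tau>" if "\<tau> \<ge> 2 * M" for \<tau>
    unfolding P_def
  proof (rule uniform_closure_inverse_Neumann[OF const_uniform_closure sub])
    fix x assume x: "x \<in> B"
    have \<tau>: "\<tau> > 0" using that M(1) by linarith
    have "1 - (\<i> / of_real \<tau>) * (u x - \<i> * of_real \<tau>) = - \<i> * u x / of_real \<tau>"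
      using \<tau> by (simp add: field_simps)
    then have "cmod (1 - (\<i> / of_real \<tau>) * (u x - \<i> * of_real \<tau>)) = cmod (u x) / \<tau>"
      using \<tau> by (simp add: norm_divide norm_mult)
    also have "\<dots> \<le> 1/2" using M(2)[OF x] that \<tau> by (simp add: field_simps)
    finally show "cmod (1 - (\<i> / of_real \<tau>) * (u x - \<i> * of_real \<tau>)) \<le> 1/2" .
  qed
  have step: "P \<tau>" if "P (\<tau> + \<eta>/2)" for \<tau>
    unfolding P_def
  proof (rule uniform_closure_inverse_Neumann[OF that[unfolded P_def] sub])
    fix x assume x: "x \<in> B"
    let ?w = "u x - \<i> * of_real (\<tau> + \<eta>/2)"
    have "\<eta> \<le> \<bar>Re ?w\<bar>" using eta(2)[OF x] by simp
    also have "\<dots> \<le> cmod ?w" by (rule abs_Re_le_cmod)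
    finally have w: "\<eta> \<le> cmod ?w" .
    then have nz: "?w \<noteq> 0" using eta(1) by auto
    have aux: "1 - 1 / w * (w + d) = - d / w" if "w \<noteq> 0" for w d :: complex
      using that by (simp add: field_simps)
    have "u x - \<i> * of_real \<tau> = ?w + \<i> * of_real (\<eta>/2)" by (simp add: algebra_simps)
    then have "1 - 1 / ?w * (u x - \<i> * of_real \<tau>) = - (\<i> * of_real (\<eta>/2)) / ?w"
      by (simp only: aux[OF nz])
    then have "cmod (1 - 1 / ?w * (u x - \<i> * of_real \<tau>)) = (\<eta>/2) / cmod ?w"
      using eta(1) by (simp only: norm_divide norm_minus_cancel norm_mult norm_ii norm_of_real)
    also have "\<dots> \<le> 1/2" using w eta(1) by (simp add: divide_simps)
    finally show "cmod (1 - 1 / ?w * (u x - \<i> * of_real \<tau>)) \<le> 1/2" .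
  qed
  have "P (real n * (\<eta>/2)) \<Longrightarrow> P 0" for n
  proof (induction n)
    case (Suc n)
    have "real (Suc n) * (\<eta>/2) = real n * (\<eta>/2) + \<eta>/2" by (simp add: field_simps)
    then have "P (real n * (\<eta>/2))" using step Suc.prems by metis
    then show ?case by (rule Suc.IH)
  qed simp
  moreover obtain n where "real n * (\<eta>/2) > 2 * M"
    using reals_Archimedean3[of "\<eta>/2"] eta(1) by (metis half_gt_zero)
  ultimately have "P 0" using far less_imp_le by blast
  then show ?thesis by (simp add: P_def)
qed

end

text \<open>
  Newton's iteration for \<open>z\<^sup>2 = 1\<close> converges to the sign of \<open>Re z\<close> and only needs inverses
  of elements whose real part stays away from 0.
\<close>

definition Newton_sign :: "complex \<Rightarrow> complex" where
  "Newton_sign z = (z + 1 / z) / 2"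

text \<open>The Moebius map \<open>(z - 1) / (z + 1)\<close> takes the right half plane to the unit
  disc and conjugates the Newton step to squaring. The bound on the real part keeps the iterates
  invertible.\<close>

lemma Newton_sign_step:
  assumes "Re z \<ge> \<eta>" "\<eta> > 0"
  shows "Re (Newton_sign z) \<ge> \<eta>/2"
    and "(Newton_sign z - 1) / (Newton_sign z + 1) = ((z - 1) / (z + 1))\<^sup>2"
proof -
  have nz: "z \<noteq> 0" "Re z > 0" using assms by auto
  define k where "k = 1 + 1 / (cmod z)\<^sup>2"
  have k: "k > 1" using nz by (simp add: k_def)
  have eq: "Re (Newton_sign z) = Re z * k / 2"
    by (simp add: k_def Newton_sign_def Re_divide cmod_power2 field_simps)
  have "Re z * 1 \<le> Re z * k" using k nz by (intro mult_left_mono) auto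
  then show "Re (Newton_sign z) \<ge> \<eta>/2"
    using assms unfolding eq by linarith
  have "Newton_sign z - 1 = (z - 1)\<^sup>2 / (2*z)" "Newton_sign z + 1 = (z + 1)\<^sup>2 / (2*z)"
    using nz by (simp_all add: Newton_sign_def field_simps power2_eq_square)
  then show "(Newton_sign z - 1) / (Newton_sign z + 1) = ((z - 1) / (z + 1))\<^sup>2"
    using nz by (simp add: power_divide)
qed

lemma Newton_sign_minus: "(Newton_sign ^^ n) (- z) = - (Newton_sign ^^ n) z"
  by (induction n) (simp_all add: Newton_sign_def field_simps)

lemma Newton_sign_iterate:
  assumes "Re z \<ge> \<eta>" "\<eta> > 0"
  shows "Re ((Newton_sign ^^ n) z) \<ge> \<eta> / 2 ^ n"
    and "((Newton_sign ^^ n) z - 1) / ((Newton_sign ^^ n) z + 1) = ((z - 1) / (z + 1)) ^ (2 ^ n)"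
proof (induction n)
  case (Suc n)
  case 1
  show ?case using Newton_sign_step(1)[OF Suc(1)] assms(2) by (simp add: field_simps)
  case 2
  show ?case
    using Newton_sign_step(2)[OF Suc(1)] assms(2) Suc(2)
    by (simp add: power_mult[symmetric] mult.commute)
qed (use assms in auto)

text \<open>The Moebius map sends this bounded part of the half plane into a disc of radius
  \<open>\<rho> < 1\<close>, so one exponent works for all its points.\<close>

lemma Newton_sign_converges:
  assumes "\<eta> > 0" "\<epsilon> > 0"
  obtains n where "\<And>z. Re z \<ge> \<eta> \<Longrightarrow> cmod z \<le> M \<Longrightarrow> cmod ((Newton_sign ^^ n) z - 1) \<le> \<epsilon>"
proof -
  define R where "R = \<bar>M\<bar> + 1"
  \<comment> \<open>This comes from \<open>(cmod ((z - 1) / (z + 1)))\<^sup>2 = 1 - 4 * Re z / (cmod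
    (z + 1))\<^sup>2\<close>. The expression is negative only if no \<open>z\<close> satisfies both
    bounds; \<open>max 0\<close> covers that case.\<close>
  define \<rho> where "\<rho> = sqrt (max 0 (1 - 4 * \<eta> / R\<^sup>2))"
  \<comment> \<open>A Moebius image of modulus at most \<open>\<delta>\<close> means distance at
    most \<open>2 * \<delta> / (1 - \<delta>)\<close> from 1, which is at most
    \<open>4 * \<delta>\<close> for \<open>\<delta> \<le> 1/2\<close>.\<close>
  define \<delta> where "\<delta> = min (1/2) (\<epsilon>/4)"
  have R: "R > 0" by (simp add: R_def)
  have \<rho>: "0 \<le> \<rho>" "\<rho> < 1" using assms(1) R by (simp_all add: \<rho>_def)
  obtain n where n: "\<rho> ^ n < \<delta>"
    using real_arch_pow_inv[of \<delta> \<rho>] \<rho> assms(2) by (auto simp: \<delta>_def)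
  show ?thesis
  proof (rule that[of n])
    fix z assume z: "Re z \<ge> \<eta>" "cmod z \<le> M"
    let ?u = "(Newton_sign ^^ n) z"
    have pos: "Re (z + 1) > 0" using z assms by simp
    then have "z + 1 \<noteq> 0" by (metis less_irrefl zero_complex.sel(1))
    then have nz: "cmod (z + 1) > 0" by simp
    have le: "cmod (z + 1) \<le> R"
      using norm_triangle_ineq[of z 1] z(2) by (simp add: R_def)
    have "(cmod (z - 1))\<^sup>2 = (cmod (z + 1))\<^sup>2 - 4 * Re z"
      unfolding cmod_power2 by (simp add: power2_eq_square algebra_simps)
    then have "(cmod ((z - 1) / (z + 1)))\<^sup>2 = 1 - 4 * Re z / (cmod (z + 1))\<^sup>2"
      using nz unfolding norm_divide power_divide by (simp add: diff_divide_distrib)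
    also have "\<dots> \<le> 1 - 4 * \<eta> / R\<^sup>2"
      using z assms nz le by (intro diff_left_mono frac_le power_mono) auto
    finally have "cmod ((z - 1) / (z + 1)) \<le> \<rho>"
      unfolding \<rho>_def by (intro real_le_rsqrt) simp
    then have "cmod (((z - 1) / (z + 1)) ^ (2 ^ n)) \<le> \<rho> ^ (2 ^ n)"
      unfolding norm_power by (intro power_mono) auto
    also have "\<dots> \<le> \<rho> ^ n"
      using \<rho> less_exp[of n] by (intro power_decreasing) auto
    also have "\<dots> \<le> \<delta>" using n by simp
    finally have "cmod ((?u - 1) / (?u + 1)) \<le> \<delta>"
      using Newton_sign_iterate(2)[OF z(1) assms(1)] by simp
    moreover have "Re ?u > 0"
      using Newton_sign_iterate(1)[OF z(1) assms(1), of n] assms(1)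
      by (smt (verit) divide_pos_pos zero_less_power)
    then have "Re (?u + 1) > 0" by simp
    then have "?u + 1 \<noteq> 0" by (metis less_irrefl zero_complex.sel(1))
    then have nz': "cmod (?u + 1) > 0" by simp
    ultimately have "cmod (?u - 1) \<le> \<delta> * cmod (?u + 1)"
      using nz' by (simp add: norm_divide field_simps)
    also have "\<dots> \<le> \<delta> * (cmod (?u - 1) + 2)"
      using norm_triangle_ineq[of "?u - 1" 2] assms(2)
      by (intro mult_left_mono) (auto simp: \<delta>_def add.commute)
    finally have "cmod (?u - 1) * (1 - \<delta>) \<le> 2 * \<delta>" by (simp add: algebra_simps)
    moreover have "cmod (?u - 1) * (1/2) \<le> cmod (?u - 1) * (1 - \<delta>)"
      by (intro mult_left_mono) (auto simp: \<delta>_def)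
    ultimately show "cmod (?u - 1) \<le> \<epsilon>" by (simp add: \<delta>_def)
  qed
qed

section \<open>Newton iterates in the uniform closure\<close>

context bounded_function_algebra
begin

text \<open>After \<open>n\<close> steps the real part still has modulus at least
  \<open>\<eta> / 2 ^ n\<close>, in the left half plane by oddness, so each further inverse exists
  in the closure.\<close>

lemma Newton_sign_uniform_closure:
  assumes u: "u \<in> UC" and \<eta>: "\<eta> > 0" "\<And>x. x \<in> B \<Longrightarrow> \<bar>Re (u x)\<bar> \<ge> \<eta>"
  shows "(\<lambda>x. (Newton_sign ^^ n) (u x)) \<in> UC"
proof (induction n)
  case (Suc n)
  let ?v = "\<lambda>x. (Newton_sign ^^ n) (u x)"
  have "\<bar>Re (?v x)\<bar> \<ge> \<eta> / 2 ^ n" if "x \<in> B" for x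
  proof (cases "Re (u x) \<ge> 0")
    case True
    then show ?thesis
      using Newton_sign_iterate(1)[of \<eta> "u x" n] \<eta>(1) \<eta>(2)[OF that] by simp
  next
    case False
    then show ?thesis
      using Newton_sign_iterate(1)[of \<eta> "- u x" n] \<eta>(1) \<eta>(2)[OF that]
      by (simp add: Newton_sign_minus)
  qed
  then have "(\<lambda>x. 1 / ?v x) \<in> UC"
    using \<eta>(1) by (intro uniform_closure_inverse[OF Suc, of "\<eta> / 2 ^ n"]) auto
  then have "(\<lambda>x. 1/2 * (?v x + 1 / ?v x)) \<in> UC"
    by (intro uniform_closure_cmult uniform_closure_add Suc)
  moreover have "(\<lambda>x. (Newton_sign ^^ Suc n) (u x)) = (\<lambda>x. 1/2 * (?v x + 1 / ?v x))"
    by (rule ext) (simp add: Newton_sign_def[of "(Newton_sign ^^ n) (u x)" for x])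
  ultimately show ?case by simp
qed (use u in simp)

text \<open>If \<open>s\<close> is the sign of \<open>Re g - c\<close>, then
  \<open>(1 + s) / 2\<close> is the indicator of the part where \<open>Re g > c\<close>. The gap
  \<open>\<eta>\<close> lets Newton iterates approximate \<open>s\<close> uniformly.\<close>

lemma approximate_idempotent:
  assumes g: "g \<in> A" and \<eta>: "\<eta> > 0" "\<And>x. x \<in> B \<Longrightarrow> \<bar>Re (g x) - c\<bar> \<ge> \<eta>" and \<epsilon>: "\<epsilon> > 0"
  obtains e where "e \<in> A" "\<And>x. x \<in> B \<Longrightarrow> Re (g x) > c \<Longrightarrow> cmod (e x - 1) \<le> \<epsilon>"
    "\<And>x. x \<in> B \<Longrightarrow> Re (g x) < c \<Longrightarrow> cmod (e x) \<le> \<epsilon>"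
proof -
  define u where "u x = g x - of_real c" for x
  have u: "u \<in> UC"
    unfolding u_def using diff_closed[OF g const_closed] subset_uniform_closure by blast
  have \<eta>u: "\<bar>Re (u x)\<bar> \<ge> \<eta>" if "x \<in> B" for x
    using \<eta>(2)[OF that] by (simp add: u_def)
  obtain M where M: "\<And>x. x \<in> B \<Longrightarrow> cmod (u x) \<le> M"
    using uniform_closure_bounded[OF u] by blast
  obtain n where n: "\<And>z. Re z \<ge> \<eta> \<Longrightarrow> cmod z \<le> M \<Longrightarrow> cmod ((Newton_sign ^^ n) z - 1) \<le> \<epsilon>"
    using Newton_sign_converges[OF \<eta>(1) \<epsilon>] by blast
  define s where "s x = (Newton_sign ^^ n) (u x)" for x
  have "s \<in> UC"
    unfolding s_def by (rule Newton_sign_uniform_closure[OF u \<eta>(1) \<eta>u])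
  then obtain a where a: "a \<in> A" "\<And>x. x \<in> B \<Longrightarrow> cmod (s x - a x) < \<epsilon>"
    using uniform_closureE \<epsilon> by metis
  define e where "e x = (1/2) * (1 + a x)" for x
  have "e \<in> A"
    unfolding e_def by (intro cmult_closed add_closed const_closed a)
  moreover have "cmod (e x - 1) \<le> \<epsilon>" if "x \<in> B" "Re (g x) > c" for x
  proof -
    have "cmod (s x - 1) \<le> \<epsilon>"
      unfolding s_def using \<eta>u[OF that(1)] that M[OF that(1)] by (intro n) (auto simp: u_def)
    then have "cmod (a x - 1) \<le> 2 * \<epsilon>"
      using norm_triangle_ineq4[of "s x - 1" "s x - a x"] a(2)[OF that(1)] by simp
    moreover have "e x - 1 = (1/2) * (a x - 1)" by (simp add: e_def field_simps)
    ultimately show ?thesis by (simp only: norm_mult) simp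
  qed
  moreover have "cmod (e x) \<le> \<epsilon>" if "x \<in> B" "Re (g x) < c" for x
  proof -
    have "cmod ((Newton_sign ^^ n) (- u x) - 1) \<le> \<epsilon>"
      using \<eta>u[OF that(1)] that M[OF that(1)]
      by (intro n) (auto simp: u_def norm_minus_commute)
    then have "cmod (- (s x + 1)) \<le> \<epsilon>"
      by (simp add: Newton_sign_minus s_def)
    then have "cmod (a x + 1) \<le> 2 * \<epsilon>"
      using norm_triangle_ineq4[of "s x + 1" "s x - a x"] a(2)[OF that(1)]
      unfolding norm_minus_cancel by (simp add: add.commute)
    then show ?thesis by (simp add: e_def norm_mult add.commute)
  qed
  ultimately show ?thesis using that by blast
qed

end

section \<open>Monotone maps on compact ordered spaces\<close>

text \<open>The neighbourhood is the intersection of an initial and a final segment; a side on which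
  \<open>x\<close> is extremal gets \<open>UNIV\<close>.\<close>

lemma open_contains_convex_open:
  fixes x :: "'a::linorder_topology"
  assumes "open S" "x \<in> S"
  obtains V where "open V" "x \<in> V" "V \<subseteq> S" "\<And>u v w. u \<in> V \<Longrightarrow> w \<in> V \<Longrightarrow> u \<le> v \<Longrightarrow> v \<le> w \<Longrightarrow> v \<in> V"
proof -
  obtain R where R: "open R" "x \<in> R" "\<And>u v. v \<in> R \<Longrightarrow> u \<le> v \<Longrightarrow> u \<in> R" "R \<inter> {x..} \<subseteq> S"
  proof (cases "\<exists>y. x < y")
    case True
    then obtain b where "b > x" "{x..<b} \<subseteq> S" using open_right[OF assms] by blast
    then show ?thesis by (intro that[of "{..<b}"]) auto
  next
    case False
    then have "{x..} \<subseteq> S" using assms(2) by (metis atLeast_iff leD le_neq_trans subsetI)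
    then show ?thesis by (intro that[of UNIV]) auto
  qed
  obtain L where L: "open L" "x \<in> L" "\<And>u v. v \<in> L \<Longrightarrow> v \<le> u \<Longrightarrow> u \<in> L" "L \<inter> {..x} \<subseteq> S"
  proof (cases "\<exists>y. y < x")
    case True
    then obtain b where "b < x" "{b<..x} \<subseteq> S" using open_left[OF assms] by blast
    then show ?thesis by (intro that[of "{b<..}"]) auto
  next
    case False
    then have "{..x} \<subseteq> S" using assms(2) by (metis atMost_iff leD le_neq_trans subsetI)
    then show ?thesis by (intro that[of UNIV]) auto
  qed
  have "L \<inter> R \<subseteq> S"
  proof
    fix y assume "y \<in> L \<inter> R"
    then show "y \<in> S" using R(4) L(4) by (cases "y \<le> x") auto
  qed
  show ?thesis
  proof (rule that[of "L \<inter> R"])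
    show "L \<inter> R \<subseteq> S" by fact
    show "v \<in> L \<inter> R" if "u \<in> L \<inter> R" "w \<in> L \<inter> R" "u \<le> v" "v \<le> w" for u v w
      using L(3)[of u v] R(3)[of w v] that by simp
  qed (use L(1,2) R(1,2) in auto)
qed

text \<open>On a convex neighbourhood of \<open>x\<close> where \<open>g\<close> stays within
  \<open>e/3\<close> of \<open>g x\<close>, moving the right end only adds or drops values close to
  \<open>g x\<close>.\<close>

lemma continuous_on_running_SUP:
  fixes g :: "'a::linorder_topology \<Rightarrow> real"
  assumes cont: "continuous_on UNIV g" and bdd: "bdd_above (range g)"
  shows "continuous_on UNIV (\<lambda>x. SUP z\<in>{..x}. g z)"
proof -
  let ?G = "\<lambda>x. SUP z\<in>{..x}. g z"
  have bddx: "bdd_above (g ` A)" for A using bdd by (rule bdd_above_mono) auto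
  have upper: "g z \<le> ?G x" if "z \<le> x" for z x
    using that bddx by (intro cSUP_upper) auto
  have mono: "?G x \<le> ?G y" if "x \<le> y" for x y
    using that bddx by (intro cSUP_subset_mono) auto
  have "\<exists>V. open V \<and> x \<in> V \<and> (\<forall>y\<in>V. dist (?G y) (?G x) < e)" if "e > 0" for x e
  proof -
    have "open (g -` ball (g x) (e/3))" using cont by (simp add: open_vimage)
    then obtain V where V: "open V" "x \<in> V" "V \<subseteq> g -` ball (g x) (e/3)"
      "\<And>u v w. u \<in> V \<Longrightarrow> w \<in> V \<Longrightarrow> u \<le> v \<Longrightarrow> v \<le> w \<Longrightarrow> v \<in> V"
      using open_contains_convex_open[of "g -` ball (g x) (e/3)" x] \<open>e > 0\<close> by auto
    have near: "\<bar>g z - g x\<bar> < e/3" if "z \<in> V" for z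
    proof -
      have "g z \<in> ball (g x) (e/3)" using V(3) that by blast
      then show ?thesis by (simp add: dist_real_def abs_minus_commute)
    qed
    have step: "?G w \<le> max (?G v) (g x + e/3)" if "v \<in> V" "w \<in> V" "v \<le> w" for v w
    proof (rule cSUP_least)
      fix z assume z: "z \<in> {..w}"
      show "g z \<le> max (?G v) (g x + e/3)"
      proof (cases "z \<le> v")
        case True then show ?thesis using upper by (simp add: le_max_iff_disj)
      next
        case False
        then have "z \<in> V" using V(4)[of v w z] that z by auto
        then show ?thesis using near[of z] by (intro max.coboundedI2) linarith
      qed
    qed auto
    have "\<bar>?G y - ?G x\<bar> < e" if y: "y \<in> V" for y
    proof (cases "x \<le> y")
      case True
      then show ?thesis
        using mono[OF True] step[OF V(2) y True] upper[of x x] that \<open>e > 0\<close> by simp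
    next
      case False
      then have "y \<le> x" by simp
      then show ?thesis
        using mono[OF \<open>y \<le> x\<close>] step[OF y V(2) \<open>y \<le> x\<close>] upper[OF order_refl, of y] near[OF y] \<open>e > 0\<close>
        by linarith
    qed
    then show ?thesis using V(1,2) by (auto simp: dist_real_def)
  qed
  then have "isCont ?G x" for x
    unfolding continuous_at tendsto_iff eventually_at_topological by metis
  then show ?thesis by (simp add: continuous_at_imp_continuous_on)
qed

section \<open>Monotone functions that separate points\<close>

lemma Hausdorff_space_euclidean_t2: "Hausdorff_space (euclidean :: 'a::t2_space topology)"
  by (simp add: Hausdorff_space_def disjnt_def) (metis hausdorff)

text \<open>The running supremum of a Urysohn function for \<open>{..c}\<close> and
  \<open>{d..}\<close> is monotone and keeps the values 0 at \<open>c\<close> and 1 at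
  \<open>d\<close>. Separation is conditional so that a function can be chosen for every
  pair.\<close>

lemma monotone_Urysohn:
  fixes c d :: "'a::linorder_topology"
  assumes "compact (UNIV :: 'a set)"
  obtains g :: "'a \<Rightarrow> real" where "continuous_on UNIV g" "mono g" "range g \<subseteq> {0..1}" "c < d \<Longrightarrow> g c < g d"
proof (cases "c < d")
  case True
  have "compact_space (euclidean :: 'a topology)" using assms by (simp add: compact_space_def)
  then have "normal_space (euclidean :: 'a topology)"
    by (rule compact_Hausdorff_or_regular_imp_normal_space) (simp add: Hausdorff_space_euclidean_t2)
  moreover have "closedin euclidean {..c}" "closedin euclidean {d..}" "disjnt {..c} {d..}"
    using True by (auto simp: disjnt_def)
  ultimately obtain h where h: "continuous_map euclidean (top_of_set {0..1::real}) h"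
    "h ` {..c} \<subseteq> {0}" "h ` {d..} \<subseteq> {1}"
    using Urysohn_lemma[of euclidean "{..c}" "{d..}" 0 1] by auto
  have hc: "continuous_on UNIV h" "\<And>x. h x \<in> {0..1}"
    using h(1) by (auto simp: continuous_map_in_subtopology)
  have bdd: "bdd_above (h ` A)" for A using hc(2) by (intro bdd_aboveI[of _ 1]) auto
  let ?G = "\<lambda>x. SUP z\<in>{..x}. h z"
  have up: "h x \<le> ?G x" for x using bdd by (intro cSUP_upper) auto
  show ?thesis
  proof (rule that[of ?G])
    show "continuous_on UNIV ?G" using hc(1) bdd by (rule continuous_on_running_SUP)
    show "mono ?G" using bdd by (intro monoI cSUP_subset_mono) auto
    have "?G x \<ge> 0" for x using up[of x] hc(2)[of x] by simp
    moreover have "?G x \<le> 1" for x using hc(2) by (intro cSUP_least) auto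
    ultimately show "range ?G \<subseteq> {0..1}" by auto
    have "?G c = (SUP z\<in>{..c}. 0)" using h(2) by (intro SUP_cong) auto
    moreover have "?G d \<ge> 1" using up[of d] h(3) by auto
    ultimately show "?G c < ?G d" by simp
  qed
next
  case False
  then show ?thesis using that[of "\<lambda>_. 0"] by (auto simp: mono_def)
qed

text \<open>A series over all pairs from \<open>C\<close> with weights \<open>(1/2) ^ n\<close>:
  each pair is separated strictly by its own term, and no other term decreases.\<close>

lemma monotone_separating_countable:
  fixes C :: "'a::linorder_topology set"
  assumes "compact (UNIV :: 'a set)" "countable C"
  obtains p :: "'a \<Rightarrow> real" where "continuous_on UNIV p" "mono p"
    "\<And>c d. c \<in> C \<Longrightarrow> d \<in> C \<Longrightarrow> c < d \<Longrightarrow> p c < p d"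
proof -
  \<comment> \<open>Inserting \<open>undefined\<close> makes \<open>D\<close> nonempty, so that
    \<open>from_nat_into\<close> enumerates it even for empty \<open>C\<close>.\<close>
  define D where "D = insert undefined C \<times> insert undefined C"
  have "countable D" "D \<noteq> {}" using assms(2) by (auto simp: D_def)
  then have rng: "range (from_nat_into D) = D" by (rule range_from_nat_into[rotated])
  have "\<exists>g::'a \<Rightarrow> real. continuous_on UNIV g \<and> mono g \<and> range g \<subseteq> {0..1} \<and> (fst q < snd q \<longrightarrow> g (fst q) < g (snd q))" for q
    using monotone_Urysohn[OF assms(1), of "fst q" "snd q"] by metis
  then obtain G :: "'a \<times> 'a \<Rightarrow> 'a \<Rightarrow> real" where G: "\<And>q. continuous_on UNIV (G q)" "\<And>q. mono (G q)" "\<And>q. range (G q) \<subseteq> {0..1}"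
    "\<And>q. fst q < snd q \<Longrightarrow> G q (fst q) < G q (snd q)"
    by metis
  define t where "t n x = (1/2) ^ n * G (from_nat_into D n) x" for n x
  have bd: "0 \<le> t n x" "t n x \<le> (1/2) ^ n" for n x
    using G(3)[of "from_nat_into D n"] by (auto simp: t_def image_subset_iff mult_left_le)
  have smb: "summable (\<lambda>n. (1/2::real) ^ n)" by (simp add: summable_geometric)
  have sm: "summable (\<lambda>n. t n x)" for x
    by (rule summable_comparison_test'[OF smb, of 0]) (use bd in auto)
  have mt: "t n x \<le> t n y" if "x \<le> y" for n x y
    using G(2) that by (simp add: t_def mono_def)
  have "uniform_limit UNIV (\<lambda>n x. \<Sum>i<n. t i x) (\<lambda>x. suminf (\<lambda>i. t i x)) sequentially"
    by (rule Weierstrass_m_test[OF _ smb]) (use bd in auto)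
  moreover have "\<forall>\<^sub>F n in sequentially. continuous_on UNIV (\<lambda>x. \<Sum>i<n. t i x)"
    unfolding t_def by (intro always_eventually allI continuous_intros G(1))
  ultimately have "continuous_on UNIV (\<lambda>x. suminf (\<lambda>i. t i x))"
    by (intro uniform_limit_theorem[where F = sequentially and f = "\<lambda>n x. \<Sum>i<n. t i x"]) auto
  moreover have "mono (\<lambda>x. suminf (\<lambda>i. t i x))"
    by (intro monoI suminf_le mt sm)
  moreover have "(\<Sum>i. t i c) < (\<Sum>i. t i d)" if "c \<in> C" "d \<in> C" "c < d" for c d
  proof -
    have "(c, d) \<in> D" using that by (simp add: D_def)
    then have "(c, d) \<in> range (from_nat_into D)" by (simp only: rng)
    then obtain n where "from_nat_into D n = (c, d)" by (metis imageE)
    then have "t n c < t n d" using G(4)[of "(c,d)"] that by (simp add: t_def)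
    then have "0 < (\<Sum>i. t i d - t i c)"
      using mt[of c d] that by (intro suminf_pos2[of _ n] summable_diff sm) auto
    then show ?thesis by (simp add: suminf_diff[OF sm sm, symmetric])
  qed
  ultimately show ?thesis by (rule that)
qed

text \<open>The order is not assumed complete. The lower bounds of \<open>P\<close> form a compact
  set, nonempty because a compact order has a least element, and its maximum is the infimum.\<close>

lemma compact_UNIV_greatest_lower_bound:
  fixes P :: "'a::linorder_topology set"
  assumes "compact (UNIV :: 'a set)" "P \<noteq> {}"
  obtains c where "\<And>p. p \<in> P \<Longrightarrow> c \<le> p" "\<And>z. c < z \<Longrightarrow> \<exists>p\<in>P. p < z"
proof -
  let ?L = "\<Inter>p\<in>P. {..p}"
  obtain m :: 'a where "\<And>x. m \<le> x" using compact_attains_inf[OF assms(1)] by auto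
  then have "?L \<noteq> {}" by auto
  moreover have "compact ?L" using compact_Int_closed[OF assms(1), of ?L] closed_INT[of P "\<lambda>p. {..p}"] by simp
  ultimately obtain c where c: "c \<in> ?L" "\<And>x. x \<in> ?L \<Longrightarrow> x \<le> c"
    using compact_attains_sup[of ?L] by blast
  show ?thesis
  proof (rule that[of c])
    show "c \<le> p" if "p \<in> P" for p using c(1) that by auto
    show "\<exists>p\<in>P. p < z" if "c < z" for z
      using c(2)[of z] that by (force simp: not_le)
  qed
qed

text \<open>
  Greedy choice: the infimum of the right endpoints pierces every interval of the family except those
  strictly to its right, and these are disjoint from some member of the family.
\<close>

lemma finite_piercing:
  fixes I :: "('a::linorder_topology \<times> 'a) set"
  assumes "compact (UNIV :: 'a set)"
    and "\<And>q. q \<in> I \<Longrightarrow> fst q < snd q"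
    and "\<And>J. J \<subseteq> I \<Longrightarrow> finite J \<Longrightarrow> pairwise (\<lambda>q r. snd q \<le> fst r \<or> snd r \<le> fst q) J \<Longrightarrow> card J \<noteq> k"
  shows "\<exists>C. finite C \<and> (\<forall>q\<in>I. \<exists>c\<in>C. fst q \<le> c \<and> c \<le> snd q)"
  using assms(2,3)
proof (induction k arbitrary: I)
  case 0
  then show ?case using "0"(2)[of "{}"] by simp
next
  case (Suc k)
  show ?case
  proof (cases "I = {}")
    case True
    then show ?thesis by (intro exI[of _ "{}"]) auto
  next
    case False
    obtain c where c: "\<And>q. q \<in> I \<Longrightarrow> c \<le> snd q" "\<And>z. c < z \<Longrightarrow> \<exists>q\<in>I. snd q < z"
    proof -
      have ne: "snd ` I \<noteq> {}" using False by simp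
      show ?thesis
        by (rule compact_UNIV_greatest_lower_bound[OF assms(1) ne]) (rule that, auto)
    qed
    define I' where "I' = {q\<in>I. c < fst q}"
    have "\<exists>C. finite C \<and> (\<forall>q\<in>I'. \<exists>c\<in>C. fst q \<le> c \<and> c \<le> snd q)"
    proof (rule Suc.IH)
      show "fst q < snd q" if "q \<in> I'" for q using that Suc.prems(1) by (simp add: I'_def)
      fix J assume J: "J \<subseteq> I'" "finite J" "pairwise (\<lambda>q r. snd q \<le> fst r \<or> snd r \<le> fst q) J"
      have "\<exists>q0\<in>I. \<forall>q\<in>J. snd q0 < fst q"
      proof (cases "J = {}")
        case True then show ?thesis using False by auto
      next
        case False
        then have "c < Min (fst ` J)" using J by (auto simp: I'_def)
        then obtain q0 where "q0 \<in> I" "snd q0 < Min (fst ` J)" using c(2) by blast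
        moreover have "Min (fst ` J) \<le> fst q" if "q \<in> J" for q using that J(2) by simp
        ultimately show ?thesis by (meson less_le_trans)
      qed
      then obtain q0 where q0: "q0 \<in> I" "\<And>q. q \<in> J \<Longrightarrow> snd q0 < fst q" by blast
      then have "q0 \<notin> J" using Suc.prems(1)[OF q0(1)] less_asym by blast
      moreover have "pairwise (\<lambda>q r. snd q \<le> fst r \<or> snd r \<le> fst q) (insert q0 J)"
        using J(3) q0(2) by (auto simp: pairwise_insert less_imp_le)
      ultimately show "card J \<noteq> k"
        using Suc.prems(2)[of "insert q0 J"] J q0(1) by (auto simp: I'_def)
    qed
    then obtain C where C: "finite C" "\<And>q. q \<in> I' \<Longrightarrow> \<exists>c\<in>C. fst q \<le> c \<and> c \<le> snd q" by blast
    show ?thesis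
    proof (intro exI[of _ "insert c C"] conjI ballI)
      fix q assume "q \<in> I"
      then show "\<exists>c'\<in>insert c C. fst q \<le> c' \<and> c' \<le> snd q"
        using C(2)[of q] c(1)[of q] by (cases "c < fst q") (auto simp: I'_def)
    qed (use C in auto)
  qed
qed

text \<open>Six points in one fiber split into two consecutive triples. Each triple spans a point of
  \<open>C\<close>, and \<open>p\<close> is strictly larger at the second of these, although both
  lie between points of the same fiber.\<close>

lemma finite_fibers_if_pierced:
  fixes p :: "'a::linorder \<Rightarrow> real"
  assumes "mono p" and sep: "\<And>c d. c \<in> C \<Longrightarrow> d \<in> C \<Longrightarrow> c < d \<Longrightarrow> p c < p d"
    and pierce: "\<And>x y z. z \<in> M \<Longrightarrow> x < z \<Longrightarrow> z < y \<Longrightarrow> \<exists>c\<in>C. x \<le> c \<and> c \<le> y"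
  shows "finite (M \<inter> p -` {t})"
proof (rule ccontr)
  assume "infinite (M \<inter> p -` {t})"
  then obtain F where F: "F \<subseteq> M \<inter> p -` {t}" "finite F" "card F = 6"
    using infinite_arbitrarily_large by blast
  define l where "l = sorted_list_of_set F"
  have len: "length l = 6" using F by (simp add: l_def)
  have mem: "l ! i \<in> M" "p (l ! i) = t" if "i < 6" for i
    using F len nth_mem[of i l] that by (auto simp: l_def)
  have less: "l ! i < l ! j" if "i < j" "j < 6" for i j
    using sorted_wrt_nth_less[of "(<)" l i j] that len by (simp add: l_def strict_sorted_list_of_set)
  obtain c where c: "c \<in> C" "l ! 0 \<le> c" "c \<le> l ! 2"
    using pierce[OF mem(1)[of 1], of "l!0" "l!2"] less by auto
  obtain d where d: "d \<in> C" "l ! 3 \<le> d" "d \<le> l ! 5"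
    using pierce[OF mem(1)[of 4], of "l!3" "l!5"] less by auto
  have "c < d" using c d less[of 2 3] by simp
  then have "p c < p d" using sep c d by blast
  moreover have "p (l!0) \<le> p c" "p d \<le> p (l!5)" using assms(1) c d by (auto simp: mono_def)
  ultimately show False using mem(2)[of 0] mem(2)[of 5] by simp
qed

text \<open>Only finitely many fibers carry an oscillation of at least \<open>e\<close>: cover
  \<open>U\<close> by finitely many convex sets on which \<open>F\<close> oscillates by less than
  \<open>e\<close>; such a fiber has to leave one of them.\<close>

lemma countable_nonconstant_fibers:
  fixes p :: "'a::linorder_topology \<Rightarrow> real" and F :: "'a \<Rightarrow> 'c::metric_space"
  assumes p: "mono p" and U: "compact U" and F: "continuous_on U F"
  shows "countable {t. \<exists>x\<in>U. \<exists>y\<in>U. p x = t \<and> p y = t \<and> F x \<noteq> F y}"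
proof -
  define T where "T e = {t. \<exists>x\<in>U. \<exists>y\<in>U. x < y \<and> p x = t \<and> p y = t \<and> dist (F x) (F y) \<ge> e}" for e
  have fin: "finite (T e)" if "e > 0" for e
  proof -
    have "\<exists>V. open V \<and> z \<in> V \<and> (\<forall>x\<in>V\<inter>U. dist (F x) (F z) < e/2) \<and>
        (\<forall>u v w. u \<in> V \<longrightarrow> w \<in> V \<longrightarrow> u \<le> v \<longrightarrow> v \<le> w \<longrightarrow> v \<in> V)" if z: "z \<in> U" for z
    proof -
      have "\<exists>A. open A \<and> A \<inter> U = F -` ball (F z) (e/2) \<inter> U"
        using F by (simp add: continuous_on_open_invariant)
      then obtain A where A: "open A" "A \<inter> U = F -` ball (F z) (e/2) \<inter> U" by blast
      have "z \<in> F -` ball (F z) (e/2) \<inter> U" using z \<open>e > 0\<close> by simp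
      then have "z \<in> A" unfolding A(2)[symmetric] by simp
      then obtain V where V: "open V" "z \<in> V" "V \<subseteq> A"
        "\<And>u v w. u \<in> V \<Longrightarrow> w \<in> V \<Longrightarrow> u \<le> v \<Longrightarrow> v \<le> w \<Longrightarrow> v \<in> V"
        using open_contains_convex_open[OF A(1)] by blast
      have near: "dist (F x) (F z) < e/2" if "x \<in> V \<inter> U" for x
      proof -
        have "x \<in> A \<inter> U" using that V(3) by blast
        then have "x \<in> F -` ball (F z) (e/2)" unfolding A(2) by simp
        then show ?thesis by (simp add: dist_commute)
      qed
      show ?thesis
        by (intro exI[of _ V] conjI ballI allI impI V(1,2) near) (assumption | rule V(4); assumption)+
    qed
    then have "\<forall>z\<in>U. \<exists>V. open V \<and> z \<in> V \<and> (\<forall>x\<in>V\<inter>U. dist (F x) (F z) < e/2) \<and>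
        (\<forall>u v w. u \<in> V \<longrightarrow> w \<in> V \<longrightarrow> u \<le> v \<longrightarrow> v \<le> w \<longrightarrow> v \<in> V)" by blast
    from bchoice[OF this] obtain V where V': "\<forall>z\<in>U. open (V z) \<and> z \<in> V z \<and> (\<forall>x\<in>V z\<inter>U. dist (F x) (F z) < e/2) \<and>
        (\<forall>u v w. u \<in> V z \<longrightarrow> w \<in> V z \<longrightarrow> u \<le> v \<longrightarrow> v \<le> w \<longrightarrow> v \<in> V z)" by (rule exE)
    have V: "open (V z)" "z \<in> V z" if "z \<in> U" for z
      using bspec[OF V' that, THEN conjunct1] bspec[OF V' that, THEN conjunct2, THEN conjunct1] .
    have Vd: "dist (F x) (F z) < e/2" if "z \<in> U" "x \<in> V z" "x \<in> U" for x z
      using bspec[OF V' \<open>z \<in> U\<close>, THEN conjunct2, THEN conjunct2, THEN conjunct1] that by simp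
    have Vc: "v \<in> V z" if "z \<in> U" "u \<in> V z" "w \<in> V z" "u \<le> v" "v \<le> w" for z u v w
      using bspec[OF V' \<open>z \<in> U\<close>, THEN conjunct2, THEN conjunct2, THEN conjunct2, rule_format, OF that(2-5)] .
    obtain D where D: "D \<subseteq> U" "finite D" "U \<subseteq> (\<Union>z\<in>D. V z)"
    proof (rule compactE_image[OF U, of U V])
      show "open (V z)" if "z \<in> U" for z using V(1)[OF that] .
      show "U \<subseteq> (\<Union>z\<in>U. V z)" using V(2) by (intro subsetI UN_I)
    qed (rule that)
    \<comment> \<open>\<open>S z\<close> collects the fibers that leave \<open>V z\<close> to the
      right. It has at most one element: for \<open>s < t\<close> in it, the exit point over
      \<open>s\<close> would lie between two points of the convex set \<open>V z\<close>.\<close>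
    define S where "S z = {t. \<exists>x\<in>U\<inter>V z. \<exists>y\<in>U - V z. x < y \<and> p x = t \<and> p y = t}" for z
    have "T e \<subseteq> (\<Union>z\<in>D. S z)"
    proof
      fix t assume "t \<in> T e"
      then obtain x y where xy: "x \<in> U" "y \<in> U" "x < y" "p x = t" "p y = t" "dist (F x) (F y) \<ge> e"
        by (auto simp: T_def)
      obtain z where z: "z \<in> D" "x \<in> V z" using D(3) xy(1) by blast
      have zU: "z \<in> U" using z D by blast
      have "y \<notin> V z"
      proof
        assume "y \<in> V z"
        then have "dist (F x) (F y) < e"
          using Vd[OF zU z(2) xy(1)] Vd[OF zU _ xy(2)] dist_triangle_half_l by metis
        then show False using xy(6) by simp
      qed
      then show "t \<in> (\<Union>z\<in>D. S z)" using z xy by (auto simp: S_def)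
    qed
    moreover have "finite (S z)" if "z \<in> D" for z
    proof -
      have less: False if st: "s \<in> S z" "t \<in> S z" "s < t" for s t
      proof -
        obtain x y where xy: "x \<in> V z" "y \<notin> V z" "x < y" "p y = s"
          using st(1) by (auto simp: S_def)
        obtain x' where x': "x' \<in> V z" "p x' = t" using st(2) by (auto simp: S_def)
        have "y < x'" using p st(3) xy(4) x'(2) by (metis linorder_not_le monoD)
        have "z \<in> U" using \<open>z \<in> D\<close> D(1) by blast
        then have "y \<in> V z" using Vc[of z x x' y] xy x' less_imp_le[OF \<open>y < x'\<close>] less_imp_le[OF xy(3)] by simp
        then show False using xy by simp
      qed
      show ?thesis
      proof (cases "S z = {}")
        case False
        then obtain s where "s \<in> S z" by blast
        then have "S z \<subseteq> {s}" using less[of s] less[of _ s] by (metis linorder_neqE singletonI subsetI)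
        then show ?thesis using finite_subset by blast
      qed simp
    qed
    ultimately show "finite (T e)" using D(2) finite_subset by blast
  qed
  have "{t. \<exists>x\<in>U. \<exists>y\<in>U. p x = t \<and> p y = t \<and> F x \<noteq> F y} \<subseteq> (\<Union>n. T (1 / real (Suc n)))"
  proof clarify
    fix t x y assume xy: "x \<in> U" "y \<in> U" "p y = p x" "F x \<noteq> F y"
    obtain n where *: "1 / real (Suc n) < dist (F x) (F y)"
      using xy(4) nat_approx_posE[of "dist (F x) (F y)"] by auto
    then have "p x \<in> T (1 / real (Suc n))"
    proof (cases "x < y")
      case True
      then show ?thesis unfolding T_def using xy less_imp_le[OF *] by blast
    next
      case False
      then have "y < x" using xy(4) by (metis linorder_neqE)
      moreover have "1 / real (Suc n) \<le> dist (F y) (F x)"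
        using less_imp_le[OF *] by (simp only: dist_commute)
      ultimately show ?thesis unfolding T_def using xy by blast
    qed
    then show "p x \<in> (\<Union>n. T (1 / real (Suc n)))" by blast
  qed
  moreover have "countable (\<Union>n. T (1 / real (Suc n)))"
    by (rule countable_UN) (simp_all add: countable_finite fin)
  ultimately show ?thesis by (rule countable_subset)
qed

section \<open>Cantor sets and nontrivial fibers\<close>

text \<open>Small closed balls around two condensation points of \<open>W\<close> other than
  \<open>a\<close>. Omitting \<open>a\<close> allows a prescribed countable set to be avoided point
  by point.\<close>

lemma split_uncountable_compact:
  fixes W :: "'a::{metric_space,second_countable_topology} set"
  assumes "compact W" "uncountable W" "e > 0"
  obtains D :: "bool \<Rightarrow> 'a set" where "\<And>b. compact (D b) \<and> uncountable (D b) \<and> D b \<subseteq> W \<and> a \<notin> D b"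
    "\<And>b x y. x \<in> D b \<Longrightarrow> y \<in> D b \<Longrightarrow> dist x y \<le> e" "D True \<inter> D False = {}"
proof -
  \<comment> \<open>By Lindelof, the points with a neighbourhood that meets \<open>W\<close> in a
    countable set make up only a countable part of \<open>W\<close>.\<close>
  define O' where "O' = {S. open S \<and> countable (W \<inter> S)}"
  obtain O1 where O1: "O1 \<subseteq> O'" "countable O1" "\<Union>O1 = \<Union>O'"
    using Lindelof[of O'] by (auto simp: O'_def)
  have "countable (W \<inter> \<Union>O1)"
  proof -
    have "countable (\<Union>S\<in>O1. W \<inter> S)" using O1 by (intro countable_UN) (auto simp: O'_def)
    then show ?thesis by (simp only: Int_Union)
  qed
  then have "uncountable (W - (W \<inter> \<Union>O1))" by (rule uncountable_minus_countable[OF assms(2)])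
  then have "infinite (W - (W \<inter> \<Union>O1) - {a})"
    by (metis countable_finite finite.emptyI finite_Diff2 finite_insert)
  then obtain P where P: "P \<subseteq> W - (W \<inter> \<Union>O1) - {a}" "card P = 2"
    using infinite_arbitrarily_large[of _ 2] by metis
  obtain x y where "P = {x, y}" "x \<noteq> y" using P(2) unfolding card_2_iff by (elim exE conjE)
  then have xy: "x \<in> W - \<Union>O'" "y \<in> W - \<Union>O'" "x \<noteq> a" "y \<noteq> a" "x \<noteq> y"
    using P(1) unfolding O1(3) by simp_all
  have unc: "uncountable (W \<inter> cball z r)" if "z \<in> W - \<Union>O'" "r > 0" for z r
  proof
    assume "countable (W \<inter> cball z r)"
    then have "countable (W \<inter> ball z r)" by (rule countable_subset[rotated]) auto
    then have "ball z r \<in> O'" by (simp add: O'_def)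
    then show False using that by auto
  qed
  \<comment> \<open>The bounds make the two balls disjoint, give them diameter at most
    \<open>e\<close>, and exclude \<open>a\<close>.\<close>
  define r where "r = min (min (dist x y / 3) (e / 2)) (min (dist x a / 2) (dist y a / 2))"
  have r: "r > 0" "r < dist x y / 2" "r \<le> e / 2" "r < dist x a" "r < dist y a"
  proof -
    have "r \<le> dist x y / 3" "r \<le> e / 2" "r \<le> dist x a / 2" "r \<le> dist y a / 2"
      unfolding r_def by linarith+
    moreover have "dist x y > 0" "dist x a > 0" "dist y a > 0" using xy by simp_all
    moreover from this have "r > 0" using assms(3) by (simp add: r_def)
    ultimately show "r > 0" "r < dist x y / 2" "r \<le> e / 2" "r < dist x a" "r < dist y a"
      by linarith+
  qed
  define D where "D b = W \<inter> cball (if b then x else y) r" for b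
  show ?thesis
  proof (rule that[of D])
    show "compact (D b) \<and> uncountable (D b) \<and> D b \<subseteq> W \<and> a \<notin> D b" for b
      using assms(1) unc xy r by (auto simp: D_def compact_Int_closed)
    show "dist u v \<le> e" if "u \<in> D b" "v \<in> D b" for b u v
      using that r(3) dist_triangle3[of u v "if b then x else y"] unfolding D_def by (simp split: if_splits)
    show "D True \<inter> D False = {}"
    proof (rule equals0I)
      fix z assume "z \<in> D True \<inter> D False"
      then have "dist x z \<le> r" "dist y z \<le> r" by (simp_all add: D_def)
      then show False using r(2) dist_triangle2[of x y z] by linarith
    qed
  qed
qed

section \<open>Cantor schemes and their preimages\<close>

lemma compact_space_Cantor_space: "compact_space Cantor_space"
  by (simp add: Cantor_space_def compact_space_product_topology compact_space_discrete_topology)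

lemma topspace_Cantor_space [simp]: "topspace Cantor_space = UNIV"
  by (simp add: Cantor_space_def)

lemma openin_Cantor_space_cylinder: "openin Cantor_space {y. \<forall>i<n. y i = x i}"
proof -
  have "{y. \<forall>i<n. y i = x i} = PiE UNIV (\<lambda>i. if i < n then {x i} else UNIV)"
    by (auto simp: PiE_UNIV_domain split: if_splits)
  moreover have "finite {i. (if i < n then {x i} else UNIV) \<noteq> UNIV}"
    by (rule finite_subset[of _ "{..<n}"]) auto
  ultimately show ?thesis unfolding Cantor_space_def by (simp add: openin_PiE_gen)
qed

text \<open>In a Cantor scheme, stage \<open>n\<close> splits every set into two disjoint
  uncountable compact pieces of diameter at most \<open>(1/2) ^ n\<close> that omit the point
  \<open>a n\<close>.\<close>

lemma Cantor_subset_avoiding_countable: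
  fixes Z :: "'a::{heine_borel,second_countable_topology} set"
  assumes "compact Z" "uncountable Z" "countable N"
  obtains K where "K \<subseteq> Z - N" "subtopology euclidean K homeomorphic_space Cantor_space"
proof -
  define a where "a = from_nat_into (insert undefined N)"
  have a: "N \<subseteq> range a"
    using assms(3) by (metis a_def countable_insert insert_not_empty range_from_nat_into subset_insertI)
  define good where "good n W D \<longleftrightarrow>
    (\<forall>b. compact (D b) \<and> uncountable (D b) \<and> D b \<subseteq> W \<and> a n \<notin> D b) \<and>
    (\<forall>b. \<forall>x\<in>D b. \<forall>y\<in>D b. dist x y \<le> (1/2)^n) \<and> D True \<inter> D False = {}"
    for n W and D :: "bool \<Rightarrow> 'a set"
  define D where "D n W = (SOME D. good n W D)" for n W
  have D: "good n W (D n W)" if W: "compact W" "uncountable W" for n W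
  proof -
    obtain E :: "bool \<Rightarrow> 'a set" where "\<And>b. compact (E b) \<and> uncountable (E b) \<and> E b \<subseteq> W \<and> a n \<notin> E b"
    "\<And>b x y. x \<in> E b \<Longrightarrow> y \<in> E b \<Longrightarrow> dist x y \<le> (1/2)^n" "E True \<inter> E False = {}"
      by (rule split_uncountable_compact[OF W, of "(1/2)^n" "a n"]) auto
    then have "good n W E" unfolding good_def by simp
    then show ?thesis unfolding D_def by (rule someI[of "good n W"])
  qed
  \<comment> \<open>The set reached along the branch \<open>x\<close> depends only on the first
    \<open>n\<close> bits. This gives continuity of the branch point, while the first differing bit
    gives injectivity.\<close>
  define Zs where "Zs x n = rec_nat Z (\<lambda>m W. D m W (x m)) n" for x :: "nat \<Rightarrow> bool" and n
  have Zs0: "Zs x 0 = Z" and ZsS: "Zs x (Suc n) = D n (Zs x n) (x n)" for x n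
    by (simp_all add: Zs_def)
  have cu: "compact (Zs x n) \<and> uncountable (Zs x n)" for x n
  proof (induction n)
    case (Suc n)
    then have "good n (Zs x n) (D n (Zs x n))" using D by blast
    then show ?case unfolding ZsS by (simp add: good_def)
  qed (simp add: Zs0 assms)
  have gd: "good n (Zs x n) (D n (Zs x n))" for x n using cu D by blast
  have dec: "Zs x (Suc n) \<subseteq> Zs x n" and av: "a n \<notin> Zs x (Suc n)" for x n
    using gd[of n x] unfolding ZsS by (auto simp: good_def)
  have diam: "dist u v \<le> (1/2)^n" if "u \<in> Zs x (Suc n)" "v \<in> Zs x (Suc n)" for u v x n
    using gd[of n x] that unfolding ZsS good_def by blast
  have agree: "(\<forall>i<n. x i = y i) \<Longrightarrow> Zs x n = Zs y n" for x y n
    by (induction n) (simp_all add: Zs0 ZsS)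
  have "\<exists>u. \<forall>n. u \<in> Zs x n" for x
  proof -
    have "\<Inter>(range (Zs x)) \<noteq> {}"
    proof (rule compact_nest)
      show "compact (Zs x n)" "Zs x n \<noteq> {}" for n using cu[of x n] by auto
      show "Zs x n \<subseteq> Zs x m" if "m \<le> n" for m n
        using that dec by (rule lift_Suc_antimono_le[rotated])
    qed
    then show ?thesis by auto
  qed
  then obtain f where f: "\<And>x n. f x \<in> Zs x n" by metis
  have "inj f"
  proof (rule injI, rule ccontr)
    fix x y assume eq: "f x = f y" and "x \<noteq> y"
    then obtain k where "x k \<noteq> y k" by auto
    define n where "n = (LEAST k. x k \<noteq> y k)"
    have n: "x n \<noteq> y n"
      unfolding n_def using \<open>x k \<noteq> y k\<close> by (rule LeastI)
    have before: "\<forall>i<n. y i = x i"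
      unfolding n_def using not_less_Least by fastforce
    have "f x \<in> D n (Zs x n) (x n)" using f[of x "Suc n"] by (simp add: ZsS)
    moreover have "f x \<in> D n (Zs x n) (y n)"
      using f[of y "Suc n"] agree[OF before] eq by (simp add: ZsS)
    moreover have "D n (Zs x n) True \<inter> D n (Zs x n) False = {}" using gd[of n x] by (simp add: good_def)
    ultimately show False using n by (cases "x n"; cases "y n") auto
  qed
  have "continuous_map Cantor_space euclidean f"
    unfolding continuous_map_def
  proof (intro conjI allI impI)
    fix S :: "'a set" assume "openin euclidean S"
    then have S: "open S" by simp
    show "openin Cantor_space {x \<in> topspace Cantor_space. f x \<in> S}"
    proof (subst openin_subopen, intro ballI)
      fix x assume "x \<in> {x \<in> topspace Cantor_space. f x \<in> S}"
      then obtain e where e: "e > 0" "ball (f x) e \<subseteq> S"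
        using S unfolding open_contains_ball by blast
      obtain n where n: "(1/2::real)^n < e" using real_arch_pow_inv[OF e(1), of "1/2"] by auto
      have "f y \<in> S" if "\<forall>i<Suc n. y i = x i" for y
      proof -
        have "Zs y (Suc n) = Zs x (Suc n)" by (rule agree[OF that])
        then have "dist (f x) (f y) \<le> (1/2)^n"
          using diam f by metis
        then show ?thesis using n e by auto
      qed
      then show "\<exists>T. openin Cantor_space T \<and> x \<in> T \<and> T \<subseteq> {x \<in> topspace Cantor_space. f x \<in> S}"
        by (intro exI[of _ "{y. \<forall>i<Suc n. y i = x i}"] conjI openin_Cantor_space_cylinder) auto
    qed
  qed auto
  then have "homeomorphic_map Cantor_space (subtopology euclidean (range f)) f"
    using \<open>inj f\<close>
    by (intro continuous_imp_homeomorphic_map)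
      (auto simp: continuous_map_in_subtopology compact_space_Cantor_space Hausdorff_space_subtopology)
  then have "subtopology euclidean (range f) homeomorphic_space Cantor_space"
    using homeomorphic_map_imp_homeomorphic_space homeomorphic_space_sym by blast
  moreover have "range f \<subseteq> Z - N"
  proof clarify
    fix x
    have "f x \<noteq> a n" for n using f[of x "Suc n"] av[of n x] by auto
    then have "f x \<notin> N" using a by auto
    then show "f x \<in> Z - N" using f[of x 0] by (simp add: Zs0)
  qed
  ultimately show ?thesis using that by blast
qed

text \<open>The image of \<open>V\<close> contains a Cantor set missing \<open>N\<close>. Over it
  \<open>p\<close> is a continuous bijection from a compact set, hence a homeomorphism.\<close>

lemma Cantor_subset_of_injective_preimage:
  fixes p :: "'a::t2_space \<Rightarrow> 'b::{heine_borel,second_countable_topology}"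
  assumes V: "compact V" and p: "continuous_on V p" and unc: "uncountable (p ` V)"
    and N: "countable N" and inj: "\<And>x y. x \<in> V \<Longrightarrow> y \<in> V \<Longrightarrow> p x = p y \<Longrightarrow> p x \<notin> N \<Longrightarrow> x = y"
  shows "\<exists>K. Cantor_subset_of (euclidean :: 'a topology) K"
proof -
  have "compact (p ` V)" using p V by (rule compact_continuous_image)
  then obtain K where K: "K \<subseteq> p ` V - N" "subtopology euclidean K homeomorphic_space Cantor_space"
    using Cantor_subset_avoiding_countable[OF _ unc N] by metis
  have "compact_space (subtopology euclidean K)"
    using homeomorphic_compact_space[OF K(2)] compact_space_Cantor_space by simp
  then have "compact K" using compactin_subspace[of euclidean K] by simp
  then have "closed K" by (rule compact_imp_closed)
  define K' where "K' = V \<inter> p -` K"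
  have "closedin (top_of_set V) K'"
    unfolding K'_def using p \<open>closed K\<close> by (rule continuous_closedin_preimage)
  then have "compact K'" using V closedin_compact by blast
  have img: "p ` K' = K" using K(1) by (auto simp: K'_def)
  have "homeomorphic_map (subtopology euclidean K') (subtopology euclidean K) p"
  proof (rule continuous_imp_homeomorphic_map)
    show "continuous_map (subtopology euclidean K') (subtopology euclidean K) p"
      using continuous_on_subset[OF p, of K'] img by (auto simp: K'_def continuous_map_in_subtopology)
    show "compact_space (subtopology euclidean K')"
      using \<open>compact K'\<close> compactin_subspace[of euclidean K'] by simp
    show "Hausdorff_space (subtopology euclidean K)"
      by (simp add: Hausdorff_space_subtopology)
    show "p ` topspace (subtopology euclidean K') = topspace (subtopology euclidean K)"
      using img by simp
    show "inj_on p (topspace (subtopology euclidean K'))"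
      using inj K(1) by (intro inj_onI) (auto simp: K'_def)
  qed
  then have "subtopology euclidean K' homeomorphic_space Cantor_space"
    using homeomorphic_map_imp_homeomorphic_space homeomorphic_space_trans K(2) by blast
  then show ?thesis by (auto simp: Cantor_subset_of_def)
qed

text \<open>Otherwise \<open>p\<close> would be injective, off countably many values, on the compact
  part of \<open>U\<close> where \<open>Re (v x) \<ge> \<rho>\<close>. That part has uncountable
  image, since \<open>Re (v x)\<close> runs through an interval there and fibers are finite, so a
  Cantor set would exist.\<close>

lemma uncountable_nontrivial_fibers:
  fixes p :: "'a::linorder_topology \<Rightarrow> real" and v :: "'a \<Rightarrow> complex"
  assumes p: "mono p" "continuous_on UNIV p" and U: "compact U" and fin: "\<And>t. finite (U \<inter> p -` {t})"
    and v: "continuous_on U v" and r: "r < r1" "\<And>c. r < c \<Longrightarrow> c < r1 \<Longrightarrow> \<exists>x\<in>U. Re (v x) = c"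
    and noCantor: "\<nexists>K. Cantor_subset_of (euclidean :: 'a topology) K"
  shows "uncountable {t. \<exists>x\<in>U. \<exists>y\<in>U. x < y \<and> p x = t \<and> p y = t \<and> r < cmod (v (Max (U \<inter> p -` {t})))}"
    (is "uncountable ?T")
proof
  assume T: "countable ?T"
  \<comment> \<open>The midpoint gives a closed condition that still implies
    \<open>r < cmod (v x)\<close> and leaves an interval of values below \<open>r1\<close>.\<close>
  define \<rho> where "\<rho> = (r + r1) / 2"
  define V where "V = U \<inter> (\<lambda>x. Re (v x)) -` {\<rho>..}"
  \<comment> \<open>Discarding fibers on which \<open>v\<close> varies makes the value at the
    maximum of a fiber equal to the value at any of its points in \<open>V\<close>.\<close>
  define N where "N = ?T \<union> {t. \<exists>x\<in>U. \<exists>y\<in>U. p x = t \<and> p y = t \<and> v x \<noteq> v y}"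
  have "countable N"
    unfolding N_def using T countable_nonconstant_fibers[OF p(1) U v] by (rule countable_Un)
  have "continuous_on U (\<lambda>x. Re (v x))" using v by (intro continuous_intros)
  then have "closedin (top_of_set U) V" unfolding V_def by (rule continuous_closedin_preimage) simp
  then have "compact V" using U closedin_compact by blast
  have pV: "continuous_on V p" using p(2) continuous_on_subset by blast
  have unc: "uncountable (p ` V)"
  proof
    assume "countable (p ` V)"
    moreover have "V \<subseteq> (\<Union>t\<in>p ` V. U \<inter> p -` {t})" by (auto simp: V_def)
    moreover have "countable (U \<inter> p -` {t})" for t using fin by (rule countable_finite)
    ultimately have "countable V" by (meson countable_UN countable_subset)
    then have "countable ((\<lambda>x. Re (v x)) ` V)" by (rule countable_image)
    moreover have "{\<rho><..<r1} \<subseteq> (\<lambda>x. Re (v x)) ` V"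
    proof
      fix c assume c: "c \<in> {\<rho><..<r1}"
      then have "r < c" "c < r1" "\<rho> \<le> c" using r(1) by (auto simp: \<rho>_def)
      then obtain x where "x \<in> U" "Re (v x) = c" using r(2) by blast
      then show "c \<in> (\<lambda>x. Re (v x)) ` V" using \<open>\<rho> \<le> c\<close> by (auto simp: V_def)
    qed
    ultimately have "countable {\<rho><..<r1}" by (rule countable_subset[rotated])
    then show False using uncountable_open_interval[of \<rho> r1] r(1) by (simp add: \<rho>_def)
  qed
  have "x = y" if xy: "x \<in> V" "y \<in> V" "p x = p y" "p x \<notin> N" for x y
  proof (rule ccontr)
    assume "x \<noteq> y"
    let ?b = "Max (U \<inter> p -` {p x})"
    have "?b \<in> U \<inter> p -` {p x}" using fin xy(1) by (intro Max_in) (auto simp: V_def)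
    then have "v ?b = v x" using xy(1,4) by (auto simp: N_def V_def)
    moreover have "r < cmod (v x)"
      using xy(1) r(1) complex_Re_le_cmod[of "v x"] by (simp add: V_def \<rho>_def)
    moreover have "\<exists>x'\<in>U. \<exists>y'\<in>U. x' < y' \<and> p x' = p x \<and> p y' = p x"
      using \<open>x \<noteq> y\<close> xy(1-3) unfolding V_def by (cases x y rule: linorder_cases) (metis IntE)+
    ultimately have "p x \<in> ?T" by (simp add: Bex_def)
    then show False using xy(4) by (simp add: N_def)
  qed
  then show False
    using Cantor_subset_of_injective_preimage[OF \<open>compact V\<close> pV unc \<open>countable N\<close>] noCantor by blast
qed

section \<open>Differences of functions separating the ends of fibers\<close>

text \<open>The differences within single fibers have only countably many real parts, so some
  \<open>c\<close> is missed; compactness of \<open>U \<times> U\<close> extends this to a margin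
  \<open>m\<close> for nearby fibers.\<close>

lemma avoidable_fiber_difference:
  fixes p :: "'a::linorder_topology \<Rightarrow> real" and F :: "'a \<Rightarrow> complex"
  assumes p: "mono p" "continuous_on UNIV p" and U: "compact U" and fin: "\<And>t. finite (U \<inter> p -` {t})"
    and F: "continuous_on U F" and ab: "\<alpha> < \<beta>"
  obtains c m where "\<alpha> < c" "c < \<beta>" "m > 0"
    "\<And>x y. x \<in> U \<Longrightarrow> y \<in> U \<Longrightarrow> \<bar>p x - p y\<bar> < m \<Longrightarrow> \<bar>Re (F x - F y) - c\<bar> \<ge> m"
proof -
  define S where "S = {t. \<exists>x\<in>U. \<exists>y\<in>U. p x = t \<and> p y = t \<and> F x \<noteq> F y}"
  define J where "J = {Re (F x - F y) |x y. x \<in> U \<and> y \<in> U \<and> p x = p y}"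
  have "countable S" unfolding S_def by (rule countable_nonconstant_fibers[OF p(1) U F])
  define I where "I t = (\<lambda>(x,y). Re (F x - F y)) ` ((U \<inter> p -` {t}) \<times> (U \<inter> p -` {t}))" for t
  have "J \<subseteq> insert 0 (\<Union>t\<in>S. I t)"
  proof
    fix j assume "j \<in> J"
    then obtain x y where xy: "x \<in> U" "y \<in> U" "p x = p y" "j = Re (F x - F y)"
      by (auto simp: J_def)
    show "j \<in> insert 0 (\<Union>t\<in>S. I t)"
    proof (cases "F x = F y")
      case True
      then show ?thesis using xy by simp
    next
      case False
      then have "p x \<in> S" unfolding S_def mem_Collect_eq using xy by metis
      moreover have "j \<in> I (p x)"
        unfolding I_def xy(4) using xy by (intro image_eqI[of _ _ "(x, y)"]) auto
      ultimately show ?thesis by blast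
    qed
  qed
  moreover have "countable (\<Union>t\<in>S. I t)"
    by (rule countable_UN[OF \<open>countable S\<close>]) (simp add: I_def countable_finite fin)
  ultimately have "countable J" by (meson countable_insert countable_subset)
  then have "\<not> {\<alpha><..<\<beta>} \<subseteq> J" using ab uncountable_open_interval countable_subset by blast
  then obtain c where c: "\<alpha> < c" "c < \<beta>" "c \<notin> J"
    by (meson greaterThanLessThan_iff subsetI)
  show ?thesis
  proof (cases "U = {}")
    case True
    then show ?thesis using c by (intro that[of c 1]) auto
  next
    case False
    \<comment> \<open>\<open>g\<close> could vanish only at a pair in one fiber whose difference has
      real part \<open>c\<close>, so its minimum is positive. Where the first summand is below half
      of it, the second is at least half.\<close>
    define g where "g = (\<lambda>(x,y). \<bar>p x - p y\<bar> + \<bar>Re (F x - F y) - c\<bar>)"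
    have pU: "continuous_on U p" using p(2) continuous_on_subset by blast
    have comp: "continuous_on (U \<times> U) (\<lambda>z. h (fst z))" "continuous_on (U \<times> U) (\<lambda>z. h (snd z))"
      if "continuous_on U h" for h :: "'a \<Rightarrow> 'b::topological_space"
      using that by (auto intro!: continuous_on_compose2[OF that] continuous_intros)
    have "continuous_on (U \<times> U) g"
      unfolding g_def case_prod_beta by (intro continuous_intros comp pU F)
    moreover have "compact (U \<times> U)" using U by (intro compact_Times)
    ultimately obtain z where z: "z \<in> U \<times> U" "\<And>w. w \<in> U \<times> U \<Longrightarrow> g z \<le> g w"
      using continuous_attains_inf[of "U \<times> U" g] False by auto
    have "g z > 0"
    proof (rule ccontr)
      assume "\<not> g z > 0"
      then have "p (fst z) = p (snd z)" "Re (F (fst z) - F (snd z)) = c"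
        by (auto simp: g_def case_prod_beta)
      then show False using c(3) z(1) unfolding J_def by (auto simp: mem_Times_iff)
    qed
    show ?thesis
    proof (rule that[OF c(1,2), of "g z / 2"])
      fix x y assume "x \<in> U" "y \<in> U" "\<bar>p x - p y\<bar> < g z / 2"
      then show "g z / 2 \<le> \<bar>Re (F x - F y) - c\<bar>" using z(2)[of "(x,y)"] by (simp add: g_def)
    qed (use \<open>g z > 0\<close> in simp)
  qed
qed

text \<open>By monotonicity, points with \<open>p y < t\<close> lie at or below the least point of
  the fiber, so that is the only fiber point they can approach; symmetrically for
  \<open>t < p y\<close>.\<close>

lemma one_sided_limits_at_fiber:
  fixes p :: "'a::linorder_topology \<Rightarrow> real" and F :: "'a \<Rightarrow> 'c::metric_space"
  assumes p: "mono p" "continuous_on UNIV p" and U: "compact U" and fin: "finite (U \<inter> p -` {t})"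
    and F: "continuous_on U F" and e: "e > 0"
  obtains d where "d > 0"
    "\<And>y. y \<in> U \<Longrightarrow> t - d < p y \<Longrightarrow> p y < t \<Longrightarrow> dist (F y) (F (Min (U \<inter> p -` {t}))) < e"
    "\<And>y. y \<in> U \<Longrightarrow> t < p y \<Longrightarrow> p y < t + d \<Longrightarrow> dist (F y) (F (Max (U \<inter> p -` {t}))) < e"
proof (cases "U \<inter> p -` {t} = {}")
  case True
  let ?K = "(\<lambda>y. \<bar>p y - t\<bar>) ` U"
  have "continuous_on U (\<lambda>y. \<bar>p y - t\<bar>)"
    using p(2) continuous_on_subset by (intro continuous_intros) blast
  then have "compact ?K" using U by (rule compact_continuous_image)
  then have "closed ?K" by (rule compact_imp_closed)
  moreover have "0 \<notin> ?K" using True by auto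
  ultimately obtain d where d: "d > 0" "ball 0 d \<subseteq> - ?K"
    using open_contains_ball_eq[of "- ?K" 0] by (auto simp: open_Compl)
  have far: "\<not> (t - d < p y \<and> p y < t + d)" if "y \<in> U" for y
  proof -
    have "\<bar>p y - t\<bar> \<in> ?K" using that by (rule imageI)
    then have "\<bar>p y - t\<bar> \<notin> ball 0 d" using d(2) by (meson ComplD subsetD)
    then show ?thesis by (auto simp: abs_less_iff)
  qed
  show ?thesis
    by (rule that[OF d(1)]) (use far d(1) in force)+
next
  case False
  define a where "a = Min (U \<inter> p -` {t})"
  define b where "b = Max (U \<inter> p -` {t})"
  have ab: "a \<in> U" "p a = t" "b \<in> U" "p b = t"
    using Min_in[OF fin False] Max_in[OF fin False] by (simp_all add: a_def b_def)
  have a_le: "a \<le> y" and le_b: "y \<le> b" if "y \<in> U" "p y = t" for y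
    using that fin by (auto simp: a_def b_def)
  have pU: "continuous_on U p" using p(2) continuous_on_subset by blast
  \<comment> \<open>The points of \<open>U \<inter> A\<close> where \<open>F\<close> is at distance
    at least \<open>e\<close> from \<open>z\<close> form a compact set that misses the fiber, so
    \<open>\<bar>p y - t\<bar>\<close> has a positive minimum on it.\<close>
  have sep: "\<exists>d>0. \<forall>y\<in>U\<inter>A. \<bar>p y - t\<bar> < d \<longrightarrow> dist (F y) z < e"
    if A: "closed A" "\<And>y. y \<in> U \<inter> A \<Longrightarrow> p y = t \<Longrightarrow> dist (F y) z < e" for A z
  proof -
    define K where "K = (U \<inter> (\<lambda>y. dist (F y) z) -` {e..}) \<inter> A"
    have "continuous_on U (\<lambda>y. dist (F y) z)" using F by (intro continuous_intros)
    then have "closedin (top_of_set U) (U \<inter> (\<lambda>y. dist (F y) z) -` {e..})"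
      by (rule continuous_closedin_preimage) simp
    then have "compact (U \<inter> (\<lambda>y. dist (F y) z) -` {e..})" using U closedin_compact by blast
    then have K: "compact K" unfolding K_def using A(1) by (rule compact_Int_closed)
    show ?thesis
    proof (cases "K = {}")
      case True
      then have "dist (F y) z < e" if "y \<in> U \<inter> A" for y using that by (auto simp: K_def not_le)
      then show ?thesis by (intro exI[of _ 1]) auto
    next
      case False
      have "K \<subseteq> U" by (auto simp: K_def)
      then have "continuous_on K (\<lambda>y. \<bar>p y - t\<bar>)"
        using continuous_on_subset[OF pU] by (intro continuous_intros) auto
      then obtain w where w: "w \<in> K" "\<And>y. y \<in> K \<Longrightarrow> \<bar>p w - t\<bar> \<le> \<bar>p y - t\<bar>"
        using continuous_attains_inf[OF K False] by blast
      have "p w \<noteq> t" using w(1) A(2)[of w] by (auto simp: K_def)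
      moreover have "dist (F y) z < e" if "y \<in> U \<inter> A" "\<bar>p y - t\<bar> < \<bar>p w - t\<bar>" for y
        using w(2)[of y] that by (intro ccontr[of "dist (F y) z < e"]) (auto simp: K_def not_less)
      ultimately show ?thesis by (intro exI[of _ "\<bar>p w - t\<bar>"]) auto
    qed
  qed
  have "y = a" if "y \<in> U \<inter> {..a}" "p y = t" for y using a_le[of y] that by auto
  then obtain d1 where d1: "d1 > 0" "\<And>y. y \<in> U \<inter> {..a} \<Longrightarrow> \<bar>p y - t\<bar> < d1 \<Longrightarrow> dist (F y) (F a) < e"
    using sep[of "{..a}" "F a"] e by fastforce
  have "y = b" if "y \<in> U \<inter> {b..}" "p y = t" for y using le_b[of y] that by auto
  then obtain d2 where d2: "d2 > 0" "\<And>y. y \<in> U \<inter> {b..} \<Longrightarrow> \<bar>p y - t\<bar> < d2 \<Longrightarrow> dist (F y) (F b) < e"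
    using sep[of "{b..}" "F b"] e by fastforce
  have "y \<le> a" if "p y < t" for y
    using that p(1) ab(2) by (metis linear monoD not_less)
  moreover have "b \<le> y" if "t < p y" for y
    using that p(1) ab(4) by (metis linear monoD not_less)
  ultimately show ?thesis
    using d1 d2 by (intro that[of "min d1 d2"]) (auto simp: a_def[symmetric] b_def[symmetric])
qed

text \<open>
  Cover the graph of \<open>F t\<close> over \<open>p\<close> by finitely many small members of a countable base. Two
  parameters \<open>s \<noteq> t\<close> share a cover, and then every value of \<open>F s - F t\<close> is close to a difference
  of two values of \<open>F t\<close> on one fiber; these form a countable compact set, whose real parts
  miss some \<open>c\<close>.
\<close>

lemma exists_disconnected_difference:
  fixes p :: "'a::linorder_topology \<Rightarrow> real" and F :: "real \<Rightarrow> 'a \<Rightarrow> complex"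
  assumes p: "mono p" "continuous_on UNIV p" and U: "compact U" and fin: "\<And>t. finite (U \<inter> p -` {t})"
    and T: "uncountable T" "\<And>t. t \<in> T \<Longrightarrow> U \<inter> p -` {t} \<noteq> {}"
    and F: "\<And>t. t \<in> T \<Longrightarrow> continuous_on U (F t)" "\<And>t. t \<in> T \<Longrightarrow> F t (Min (U \<inter> p -` {t})) = 0"
      "\<And>t. t \<in> T \<Longrightarrow> F t (Max (U \<inter> p -` {t})) = 1"
  obtains s t c where "s \<in> T" "t \<in> T" "1/2 < c" "\<And>x. x \<in> U \<Longrightarrow> Re (F s x - F t x) \<noteq> c"
    "\<exists>x\<in>U. Re (F s x - F t x) < c" "\<exists>x\<in>U. Re (F s x - F t x) > c"
proof -
  define a where "a t = Min (U \<inter> p -` {t})" for t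
  define b where "b t = Max (U \<inter> p -` {t})" for t
  have ab: "a t \<in> U" "p (a t) = t" "b t \<in> U" "p (b t) = t" if "t \<in> T" for t
    using Min_in[OF fin T(2)[OF that]] Max_in[OF fin T(2)[OF that]] by (simp_all add: a_def b_def)
  \<comment> \<open>The real parts found over the fiber of \<open>s\<close> will be below 1/8 and
    above 7/8, on either side of \<open>c\<close>. The lower bound 1/2 keeps \<open>c\<close> above
    the small values later found off the slice.\<close>
  have "\<exists>c m. 1/2 < c \<and> c < 3/4 \<and> m > 0 \<and>
      (\<forall>x\<in>U. \<forall>y\<in>U. \<bar>p x - p y\<bar> < m \<longrightarrow> \<bar>Re (F t x - F t y) - c\<bar> \<ge> m)" if "t \<in> T" for t
    by (rule avoidable_fiber_difference[OF p U fin F(1)[OF that], of "1/2" "3/4"]) (simp, blast)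
  then obtain c m where c: "\<And>t. t \<in> T \<Longrightarrow> 1/2 < c t" "\<And>t. t \<in> T \<Longrightarrow> c t < 3/4" and m: "\<And>t. t \<in> T \<Longrightarrow> m t > 0"
    and avoid: "\<And>t x y. t \<in> T \<Longrightarrow> x \<in> U \<Longrightarrow> y \<in> U \<Longrightarrow> \<bar>p x - p y\<bar> < m t \<Longrightarrow> \<bar>Re (F t x - F t y) - c t\<bar> \<ge> m t"
    by metis
  have "\<exists>d>0. (\<forall>y\<in>U. t - d < p y \<longrightarrow> p y < t \<longrightarrow> cmod (F t y) < 1/8) \<and>
      (\<forall>y\<in>U. t < p y \<longrightarrow> p y < t + d \<longrightarrow> cmod (F t y - 1) < 1/8)" if "t \<in> T" for t
    by (rule one_sided_limits_at_fiber[OF p U fin F(1)[OF that], of "1/8" t])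
      (simp, auto simp: F(2,3)[OF that] dist_norm)
  then obtain d where d: "\<And>t. t \<in> T \<Longrightarrow> d t > 0"
    and left: "\<And>t y. t \<in> T \<Longrightarrow> y \<in> U \<Longrightarrow> t - d t < p y \<Longrightarrow> p y < t \<Longrightarrow> cmod (F t y) < 1/8"
    and right: "\<And>t y. t \<in> T \<Longrightarrow> y \<in> U \<Longrightarrow> t < p y \<Longrightarrow> p y < t + d t \<Longrightarrow> cmod (F t y - 1) < 1/8"
    by metis
  obtain \<B> :: "(real \<times> complex) set set" where \<B>: "countable \<B>" "topological_basis \<B>"
    using ex_countable_basis by blast
  obtain \<D> :: "real set set" where \<D>: "countable \<D>" "topological_basis \<D>"
    using ex_countable_basis by blast
  define \<Gamma> where "\<Gamma> t = (\<lambda>x. (p x, F t x)) ` U" for t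
  have "\<exists>W\<subseteq>\<B>. finite W \<and> \<Gamma> t \<subseteq> \<Union>W \<and> (\<forall>B\<in>W. \<exists>z\<in>\<Gamma> t. B \<subseteq> ball z (m t / 2))" if t: "t \<in> T" for t
  proof -
    have "continuous_on U p" using p(2) continuous_on_subset by blast
    then have comp: "compact (\<Gamma> t)"
      unfolding \<Gamma>_def using U F(1)[OF t] by (intro compact_continuous_image continuous_on_Pair)
    have "\<exists>B\<in>\<B>. z \<in> B \<and> B \<subseteq> ball z (m t / 2)" for z
      by (rule topological_basisE[OF \<B>(2) open_ball, of z z "m t / 2"]) (simp add: m[OF t], blast)
    then obtain \<beta> where \<beta>: "\<And>z. \<beta> z \<in> \<B>" "\<And>z. z \<in> \<beta> z" "\<And>z. \<beta> z \<subseteq> ball z (m t / 2)" by metis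
    obtain C where C: "C \<subseteq> \<Gamma> t" "finite C" "\<Gamma> t \<subseteq> (\<Union>z\<in>C. \<beta> z)"
    proof (rule compactE_image[OF comp])
      show "open (\<beta> z)" for z using topological_basis_open[OF \<B>(2) \<beta>(1)] .
      show "\<Gamma> t \<subseteq> (\<Union>z\<in>\<Gamma> t. \<beta> z)" using \<beta>(2) by (intro subsetI UN_I)
    qed (rule that)
    show ?thesis
    proof (intro exI[of _ "\<beta> ` C"] conjI ballI)
      show "\<exists>z\<in>\<Gamma> t. B \<subseteq> ball z (m t / 2)" if "B \<in> \<beta> ` C" for B
        using that C(1) \<beta>(3) by (metis imageE subsetD)
    qed (use C \<beta>(1) in auto)
  qed
  then obtain W where W: "\<And>t. t \<in> T \<Longrightarrow> W t \<subseteq> \<B>" "\<And>t. t \<in> T \<Longrightarrow> finite (W t)" "\<And>t. t \<in> T \<Longrightarrow> \<Gamma> t \<subseteq> \<Union>(W t)"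
    "\<And>t B. t \<in> T \<Longrightarrow> B \<in> W t \<Longrightarrow> \<exists>z\<in>\<Gamma> t. B \<subseteq> ball z (m t / 2)" by metis
  have "\<exists>B\<in>\<D>. t \<in> B \<and> B \<subseteq> ball t (d t)" if "t \<in> T" for t
    by (rule topological_basisE[OF \<D>(2) open_ball, of t t "d t"]) (simp add: d[OF that], blast)
  then obtain V where V: "\<And>t. t \<in> T \<Longrightarrow> V t \<in> \<D>" "\<And>t. t \<in> T \<Longrightarrow> t \<in> V t" "\<And>t. t \<in> T \<Longrightarrow> V t \<subseteq> ball t (d t)"
    by metis
  have "countable ({A. finite A \<and> A \<subseteq> \<B>} \<times> \<D>)"
    using \<B>(1) \<D>(1) countable_Collect_finite_subset by blast
  moreover have "(\<lambda>t. (W t, V t)) ` T \<subseteq> {A. finite A \<and> A \<subseteq> \<B>} \<times> \<D>" using W V by auto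
  ultimately have "countable ((\<lambda>t. (W t, V t)) ` T)" by (rule countable_subset[rotated])
  then have "\<not> inj_on (\<lambda>t. (W t, V t)) T" using T(1) countable_image_inj_on by blast
  then obtain s t where st: "s \<in> T" "t \<in> T" "s \<noteq> t" "W s = W t" "V s = V t"
    by (auto simp: inj_on_def)
  \<comment> \<open>The shared basic neighbourhood brings the fiber over \<open>s\<close> within
    reach of the one-sided limits of \<open>F t\<close>.\<close>
  have near: "\<bar>s - t\<bar> < d t" using V(2)[OF st(1)] V(3)[OF st(2)] st(5) by (auto simp: dist_real_def)
  have match: "\<exists>y\<in>U. \<bar>p x - p y\<bar> < m t / 2 \<and> cmod (F s x - F t y) < m t / 2" if "x \<in> U" for x
  proof -
    have "(p x, F s x) \<in> \<Gamma> s" using that by (simp add: \<Gamma>_def)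
    then obtain B where B: "B \<in> W t" "(p x, F s x) \<in> B" using W(3)[OF st(1)] st(4) by auto
    then obtain z where "z \<in> \<Gamma> t" "B \<subseteq> ball z (m t / 2)" using W(4)[OF st(2)] by blast
    then obtain y where y: "y \<in> U" "dist (p y, F t y) (p x, F s x) < m t / 2"
      using B(2) by (auto simp: \<Gamma>_def)
    have "dist (p x) (p y) < m t / 2" "dist (F s x) (F t y) < m t / 2"
      using y(2) dist_fst_le[of "(p y, F t y)" "(p x, F s x)"] dist_snd_le[of "(p y, F t y)" "(p x, F s x)"]
      by (simp_all add: dist_commute)
    then show ?thesis using y(1) by (auto simp: dist_norm)
  qed
  \<comment> \<open>Both differences are treated, because the order of \<open>s\<close> and
    \<open>t\<close> decides which one is used: \<open>F t\<close> is near 0 over \<open>s\<close>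
    if \<open>s < t\<close> and near 1 otherwise.\<close>
  have ne: "Re (F s x - F t x) \<noteq> c t \<and> Re (F t x - F s x) \<noteq> c t" if x: "x \<in> U" for x
  proof -
    obtain y where y: "y \<in> U" "\<bar>p x - p y\<bar> < m t / 2" "cmod (F s x - F t y) < m t / 2"
      using match[OF x] by blast
    have "\<bar>Re (F s x) - Re (F t y)\<bar> < m t / 2"
      using y(3) abs_Re_le_cmod[of "F s x - F t y"] by simp
    moreover have "\<bar>Re (F t x - F t y) - c t\<bar> \<ge> m t" "\<bar>Re (F t y - F t x) - c t\<bar> \<ge> m t"
      using avoid[OF st(2) x y(1)] avoid[OF st(2) y(1) x] y(2) m[OF st(2)] by (simp_all add: abs_minus_commute)
    ultimately show ?thesis using m[OF st(2)] by (simp add: abs_if split: if_splits)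
  qed
  have Fs: "F s (a s) = 0" "F s (b s) = 1" using F(2,3)[OF st(1)] by (simp_all add: a_def b_def)
  note abs = ab[OF st(1)] and ct = c[OF st(2)]
  show ?thesis
  proof (cases "s < t")
    case True
    have "cmod (F t (a s)) < 1/8" "cmod (F t (b s)) < 1/8"
      using left[OF st(2)] abs near True by simp_all
    then have "Re (F s (a s) - F t (a s)) < c t" "Re (F s (b s) - F t (b s)) > c t"
      using abs_Re_le_cmod[of "F t (a s)"] abs_Re_le_cmod[of "F t (b s)"] ct Fs by simp_all
    then show ?thesis using ne ct abs st by (intro that[of s t "c t"]) auto
  next
    case False
    have "cmod (F t (a s) - 1) < 1/8" "cmod (F t (b s) - 1) < 1/8"
      using right[OF st(2)] abs near False st(3) by simp_all
    then have "Re (F t (b s) - F s (b s)) < c t" "Re (F t (a s) - F s (a s)) > c t"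
      using abs_Re_le_cmod[of "F t (a s) - 1"] abs_Re_le_cmod[of "F t (b s) - 1"] ct Fs by simp_all
    then show ?thesis using ne ct abs st by (intro that[of t s "c t"]) auto
  qed
qed

section \<open>Minimal closed sets\<close>

text \<open>Zorn's lemma for the open complements: by compactness, a \<open>Z\<close> covered by the
  union of a chain is covered by one of its members. It provides both \<open>Y\<close> and its
  minimal boundary.\<close>

lemma minimal_closed_transversal:
  assumes X: "compact_space X" and ZZ: "\<And>Z. Z \<in> ZZ \<Longrightarrow> closedin X Z"
    and Y0: "closedin X Y0" "\<And>Z. Z \<in> ZZ \<Longrightarrow> Y0 \<inter> Z \<noteq> {}"
  obtains Y where "closedin X Y" "Y \<subseteq> Y0" "\<And>Z. Z \<in> ZZ \<Longrightarrow> Y \<inter> Z \<noteq> {}"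
    "\<And>W. closedin X W \<Longrightarrow> W \<subset> Y \<Longrightarrow> \<exists>Z\<in>ZZ. W \<inter> Z = {}"
proof -
  define \<A> where "\<A> = {G. openin X G \<and> topspace X - Y0 \<subseteq> G \<and> (\<forall>Z\<in>ZZ. \<not> Z \<subseteq> G)}"
  have "\<exists>G\<in>\<A>. \<forall>H\<in>\<A>. G \<subseteq> H \<longrightarrow> H = G"
  proof (rule subset_Zorn_nonempty)
    have "topspace X - Y0 \<in> \<A>"
      using Y0 ZZ closedin_subset by (fastforce simp: \<A>_def)
    then show "\<A> \<noteq> {}" by blast
  next
    fix \<C> assume \<C>: "\<C> \<noteq> {}" "subset.chain \<A> \<C>"
    then have sub: "\<C> \<subseteq> \<A>" by (simp add: subset.chain_def)
    have "openin X (\<Union>\<C>)" using sub by (intro openin_Union) (auto simp: \<A>_def)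
    moreover have "topspace X - Y0 \<subseteq> \<Union>\<C>" using sub \<C>(1) by (fastforce simp: \<A>_def)
    moreover have "\<not> Z \<subseteq> \<Union>\<C>" if Z: "Z \<in> ZZ" for Z
    proof
      assume "Z \<subseteq> \<Union>\<C>"
      moreover have "compactin X Z" using X ZZ[OF Z] closedin_compact_space by blast
      moreover have "\<forall>G\<in>\<C>. openin X G" using sub by (auto simp: \<A>_def)
      ultimately obtain \<F> where \<F>: "finite \<F>" "\<F> \<subseteq> \<C>" "Z \<subseteq> \<Union>\<F>"
        unfolding compactin_def by meson
      show False
      proof (cases "\<F> = {}")
        case True
        then show False using \<F>(3) Y0(2)[OF Z] by simp
      next
        case False
        have "subset.chain \<A> \<F>" using \<C>(2) \<F>(2) unfolding subset.chain_def by blast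
        then have "\<Union>\<F> \<in> \<F>" using \<F>(1) False by (simp add: Union_in_chain)
        then show False using sub \<F>(2,3) Z by (auto simp: \<A>_def)
      qed
    qed
    ultimately show "\<Union>\<C> \<in> \<A>" by (simp add: \<A>_def)
  qed
  then obtain G where G: "G \<in> \<A>" and max: "\<And>H. H \<in> \<A> \<Longrightarrow> G \<subseteq> H \<Longrightarrow> H = G" by blast
  show ?thesis
  proof (rule that[of "topspace X - G"])
    show "closedin X (topspace X - G)" using G by (auto simp: \<A>_def)
    show "topspace X - G \<subseteq> Y0" using G by (auto simp: \<A>_def)
    show "(topspace X - G) \<inter> Z \<noteq> {}" if "Z \<in> ZZ" for Z
    proof -
      have "\<not> Z \<subseteq> G" using that G by (simp add: \<A>_def)
      then show ?thesis using closedin_subset[OF ZZ[OF that]] by auto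
    qed
    show "\<exists>Z\<in>ZZ. W \<inter> Z = {}" if W: "closedin X W" "W \<subset> topspace X - G" for W
    proof (rule ccontr)
      assume *: "\<not> (\<exists>Z\<in>ZZ. W \<inter> Z = {})"
      have GX: "G \<subseteq> topspace X" using G by (simp add: \<A>_def openin_subset)
      then have sub: "G \<subseteq> topspace X - W" using W(2) by blast
      have "topspace X - W \<in> \<A>"
        using W(1) sub G * by (fastforce simp: \<A>_def)
      then have "topspace X - W = G" using max sub by blast
      then show False using W(2) closedin_subset[OF W(1)] by blast
    qed
  qed
qed

text \<open>
  The polynomial \<open>3z\<^sup>2 - 2z\<^sup>3\<close> has 0 and 1 as superattracting fixed points, so its iterates
  improve a function that is roughly idempotent.
\<close>

definition smoothstep :: "complex \<Rightarrow> complex" where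
  "smoothstep z = 3 * z\<^sup>2 - 2 * z ^ 3"

text \<open>The symmetry exchanges the fixed points 0 and 1, so contraction towards 0 also gives
  contraction towards 1.\<close>

lemma smoothstep_flip: "(smoothstep ^^ n) (1 - z) = 1 - (smoothstep ^^ n) z"
proof -
  have "smoothstep (1 - w) = 1 - smoothstep w" for w
    by (simp add: smoothstep_def power2_eq_square power3_eq_cube algebra_simps)
  then show ?thesis by (induction n) simp_all
qed

lemma smoothstep_iterate:
  assumes "cmod z \<le> 1/4" shows "cmod ((smoothstep ^^ n) z) \<le> (7/8) ^ n * (1/4)"
proof (induction n)
  case (Suc n)
  let ?w = "(smoothstep ^^ n) z"
  have "(7/8::real) ^ n * (1/4) \<le> 1 * (1/4)" by (intro mult_right_mono power_le_one) auto
  then have w: "cmod ?w \<le> 1/4" using Suc by simp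
  have "smoothstep ?w = ?w * (?w * (3 - 2 * ?w))"
    by (simp add: smoothstep_def power2_eq_square power3_eq_cube algebra_simps)
  then have "cmod (smoothstep ?w) = cmod ?w * (cmod ?w * cmod (3 - 2 * ?w))"
    by (simp only: norm_mult)
  \<comment> \<open>On the disc of radius 1/4, \<open>cmod (3 - 2 * z)\<close> is at most 7/2; the
    contraction factor 7/8 is the product of these bounds.\<close>
  also have "\<dots> \<le> cmod ?w * ((1/4) * (7/2))"
    using w norm_triangle_ineq4[of 3 "2 * ?w"] by (intro mult_left_mono mult_mono) (auto simp: norm_mult)
  also have "\<dots> \<le> ((7/8) ^ n * (1/4)) * ((1/4) * (7/2))" using Suc by (intro mult_right_mono) auto
  finally show ?case by simp
qed (use assms in simp)

section \<open>Algebras of continuous functions on a compact space\<close>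

locale compact_function_algebra = unital_function_algebra A
  for A :: "('x \<Rightarrow> complex) set" +
  fixes X :: "'x topology"
  assumes compact: "compact_space X"
    and continuous: "g \<in> A \<Longrightarrow> continuous_map X euclidean g"
begin

lemma smoothstep_closed: "e \<in> A \<Longrightarrow> (\<lambda>x. (smoothstep ^^ n) (e x)) \<in> A"
proof (induction n)
  case (Suc n)
  then show ?case
    using diff_closed[OF cmult_closed[OF power_closed, of _ 3 2] cmult_closed[OF power_closed, of _ 2 3]]
    by (simp add: smoothstep_def[of "(smoothstep ^^ n) (e x)" for x])
qed simp

lemma attains_max_on_closed:
  assumes "closedin X K" "K \<noteq> {}" "continuous_map X euclideanreal h"
  obtains x where "x \<in> K" "\<And>y. y \<in> K \<Longrightarrow> h y \<le> h x"
proof -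
  have "compactin X K" using compact assms(1) closedin_compact_space by blast
  then have "compact (h ` K)" using image_compactin[OF _ assms(3)] by simp
  then obtain m where "m \<in> h ` K" "\<And>y. y \<in> h ` K \<Longrightarrow> y \<le> m"
    using compact_attains_sup[of "h ` K"] assms(2) by auto
  then show ?thesis using that by auto
qed

lemma continuous_map_cmod_diff:
  assumes "continuous_map X euclidean f" "g \<in> A"
  shows "continuous_map X euclideanreal (\<lambda>x. cmod (f x - g x))"
  using assms(1) continuous[OF assms(2)] by (intro continuous_map_norm continuous_map_diff)

lemma continuous_map_cmod: "g \<in> A \<Longrightarrow> continuous_map X euclideanreal (\<lambda>x. cmod (g x))"
  by (intro continuous_map_norm continuous)

lemma strict_bound_on_closed:
  assumes "closedin X K" "continuous_map X euclideanreal h" "\<And>y. y \<in> K \<Longrightarrow> h y < d"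
  obtains d' where "d' < d" "\<And>y. y \<in> K \<Longrightarrow> h y \<le> d'"
proof (cases "K = {}")
  case True
  then show ?thesis using that[of "d - 1"] by auto
next
  case False
  then obtain x where "x \<in> K" "\<And>y. y \<in> K \<Longrightarrow> h y \<le> h x"
    using attains_max_on_closed[OF assms(1) _ assms(2)] by blast
  then show ?thesis using that[of "h x"] assms(3) by blast
qed

lemma bounded_on_closed:
  assumes "closedin X K" "continuous_map X euclideanreal h"
  obtains M where "M > 0" "\<And>y. y \<in> K \<Longrightarrow> h y \<le> M"
proof (cases "K = {}")
  case True
  then show ?thesis using that[of 1] by auto
next
  case False
  then obtain x where "x \<in> K" "\<And>y. y \<in> K \<Longrightarrow> h y \<le> h x"
    using attains_max_on_closed[OF assms(1) _ assms(2)] by blast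
  then show ?thesis using that[of "max 1 (h x)"] by force
qed

lemma closedin_le:
  assumes "closedin X K" "continuous_map X euclideanreal h"
  shows "closedin X {x \<in> K. h x \<le> c}"
proof -
  have "closedin X {x \<in> topspace X. h x \<in> {..c}}"
    by (rule closedin_continuous_map_preimage[OF assms(2)]) simp
  then have "closedin X (K \<inter> {x \<in> topspace X. h x \<in> {..c}})" using assms(1) by (intro closedin_Int)
  also have "K \<inter> {x \<in> topspace X. h x \<in> {..c}} = {x \<in> K. h x \<le> c}"
    using closedin_subset[OF assms(1)] by auto
  finally show ?thesis .
qed

text \<open>\<open>e\<close> splits \<open>Y\<close> into two proper closed pieces, where it is near
  0 or near 1. By minimality each has an approximation with error below \<open>d\<close>, and a high
  smoothstep iterate of \<open>e\<close> glues the two.\<close>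

lemma no_approximate_idempotent:
  assumes f: "continuous_map X euclidean f" and Y: "closedin X Y"
    and far: "\<And>g. g \<in> A \<Longrightarrow> \<exists>y\<in>Y. d \<le> cmod (f y - g y)"
    and min: "\<And>W. closedin X W \<Longrightarrow> W \<subset> Y \<Longrightarrow> \<exists>g\<in>A. \<forall>y\<in>W. cmod (f y - g y) < d"
    and e: "e \<in> A" "\<And>y. y \<in> Y \<Longrightarrow> cmod ((e y)\<^sup>2 - e y) \<le> 1/16"
    and y: "y1 \<in> Y" "y2 \<in> Y" "cmod (e y1) \<le> 1/4" "cmod (e y2 - 1) \<le> 1/4"
  shows False
proof -
  define Y1 where "Y1 = {y\<in>Y. cmod (e y) \<le> 1/4}"
  define Y2 where "Y2 = {y\<in>Y. cmod (e y - 1) \<le> 1/4}"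
  have clo: "closedin X Y1" "closedin X Y2"
    unfolding Y1_def Y2_def
    by (intro closedin_le Y continuous_map_cmod e diff_closed const_closed)+
  have "y2 \<notin> Y1" "y1 \<notin> Y2"
    using y norm_triangle_ineq4[of "e y2" "e y2 - 1"] norm_triangle_ineq4[of "e y1" "e y1 - 1"]
    by (auto simp: Y1_def Y2_def)
  then have "Y1 \<subset> Y" "Y2 \<subset> Y" using y by (auto simp: Y1_def Y2_def)
  then obtain g1 g2 where g1: "g1 \<in> A" "\<And>y. y \<in> Y1 \<Longrightarrow> cmod (f y - g1 y) < d"
    and g2: "g2 \<in> A" "\<And>y. y \<in> Y2 \<Longrightarrow> cmod (f y - g2 y) < d"
    using min clo by metis
  obtain d1 where d1: "d1 < d" "\<And>y. y \<in> Y1 \<Longrightarrow> cmod (f y - g1 y) \<le> d1"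
    using strict_bound_on_closed[OF clo(1) continuous_map_cmod_diff[OF f g1(1)] g1(2)] by blast
  obtain d2 where d2: "d2 < d" "\<And>y. y \<in> Y2 \<Longrightarrow> cmod (f y - g2 y) \<le> d2"
    using strict_bound_on_closed[OF clo(2) continuous_map_cmod_diff[OF f g2(1)] g2(2)] by blast
  obtain M where M: "M > 0" "\<And>y. y \<in> Y \<Longrightarrow> cmod (g1 y - g2 y) \<le> M"
    using bounded_on_closed[OF Y continuous_map_cmod[OF diff_closed[OF g1(1) g2(1)]]] by blast
  obtain n where "(7/8::real) ^ n < (d - max d1 d2) / M"
    using real_arch_pow_inv[of "(d - max d1 d2) / M" "7/8"] d1 d2 M(1) by auto
  then have n: "(7/8) ^ n * M < d - max d1 d2" using M(1) by (simp add: field_simps)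
  define u where "u y = (smoothstep ^^ n) (e y)" for y
  define g where "g y = g1 y + u y * (g2 y - g1 y)" for y
  have "g \<in> A"
    unfolding g_def u_def by (intro add_closed mult_closed diff_closed g1(1) g2(1) smoothstep_closed e(1))
  \<comment> \<open>Used with \<open>v = u y\<close> where \<open>e\<close> is near 0 and with
    \<open>v = 1 - u y\<close> where it is near 1: the foreign approximation enters with a tiny
    coefficient.\<close>
  have mix: "cmod (f y - (h y + v * (k y - h y))) < d"
    if "cmod (f y - h y) \<le> d'" "d' \<le> max d1 d2" "cmod v \<le> (7/8) ^ n * (1/4)" "cmod (k y - h y) \<le> M"
    for y h k v d'
  proof -
    have "cmod (v * (k y - h y)) \<le> ((7/8) ^ n * (1/4)) * M"
      unfolding norm_mult using that M(1) by (intro mult_mono) auto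
    also have "\<dots> \<le> (7/8) ^ n * M" using M(1) by simp
    finally have "cmod (v * (k y - h y)) < d - max d1 d2" using n by simp
    moreover have eq: "f y - (h y + v * (k y - h y)) = (f y - h y) - v * (k y - h y)" by simp
    ultimately show ?thesis
      unfolding eq using norm_triangle_ineq4[of "f y - h y" "v * (k y - h y)"] that(1,2) by linarith
  qed
  have "cmod (f y - g y) < d" if yY: "y \<in> Y" for y
  proof (cases "cmod (e y) \<le> 1/4")
    case True
    then show ?thesis
      unfolding g_def using d1(2) M(2)[OF yY] yY smoothstep_iterate[OF True, of n]
      by (intro mix[of _ g1 d1]) (auto simp: Y1_def u_def norm_minus_commute)
  next
    case False
    \<comment> \<open>A product of at most 1/16 forces one factor to be at most 1/4, so the two
      pieces cover \<open>Y\<close>.\<close>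
    have "cmod (e y) * cmod (e y - 1) \<le> 1/16"
      using e(2)[OF yY] by (simp add: power2_eq_square norm_mult[symmetric] algebra_simps)
    then have *: "cmod (e y - 1) \<le> 1/4"
      using False mult_strict_mono[of "1/4" "cmod (e y)" "1/4" "cmod (e y - 1)"] by fastforce
    then have **: "cmod (1 - u y) \<le> (7/8) ^ n * (1/4)"
      using smoothstep_iterate[of "1 - e y" n] by (simp add: smoothstep_flip u_def norm_minus_commute)
    have "g y = g2 y + (1 - u y) * (g1 y - g2 y)" by (simp add: g_def algebra_simps)
    moreover have "cmod (f y - (g2 y + (1 - u y) * (g1 y - g2 y))) < d"
      using d2(2) M(2)[OF yY] yY * ** by (intro mix[of _ g2 d2]) (auto simp: Y2_def)
    ultimately show ?thesis by simp
  qed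
  then show False using far[OF \<open>g \<in> A\<close>] by force
qed

text \<open>
  A function that is almost idempotent on the boundary \<open>B\<close> is almost idempotent on \<open>Y\<close>, since
  \<open>e\<^sup>2 - e\<close> belongs to \<open>A\<close>.
\<close>

lemma connected_Re_of_boundary:
  assumes Y: "closedin X Y" and B: "closedin X B" "B \<subseteq> Y"
    and bdry: "\<And>g y. g \<in> A \<Longrightarrow> y \<in> Y \<Longrightarrow> \<exists>b\<in>B. cmod (g y) \<le> cmod (g b)"
    and noidem: "\<And>e y1 y2. e \<in> A \<Longrightarrow> (\<And>y. y \<in> Y \<Longrightarrow> cmod ((e y)\<^sup>2 - e y) \<le> 1/16) \<Longrightarrow>
       y1 \<in> Y \<Longrightarrow> y2 \<in> Y \<Longrightarrow> cmod (e y1) \<le> 1/4 \<Longrightarrow> cmod (e y2 - 1) \<le> 1/4 \<Longrightarrow> False"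
    and g: "g \<in> A" "b1 \<in> B" "b2 \<in> B" "Re (g b1) < c" "c < Re (g b2)"
  shows "\<exists>b\<in>B. Re (g b) = c"
proof (rule ccontr)
  assume no: "\<not> (\<exists>b\<in>B. Re (g b) = c)"
  interpret bounded_function_algebra A B
  proof
    fix h assume "h \<in> A"
    then obtain M where "\<And>b. b \<in> B \<Longrightarrow> cmod (h b) \<le> M"
      using bounded_on_closed[OF B(1) continuous_map_cmod] by blast
    then show "bounded (h ` B)" by (auto simp: bounded_iff)
  qed
  have "continuous_map X euclideanreal (\<lambda>x. Re (g x))"
    using continuous_map_compose[OF continuous[OF g(1)], of euclideanreal Re]
    by (simp add: o_def continuous_on_Re)
  then have "continuous_map X euclideanreal (\<lambda>x. - \<bar>Re (g x) - c\<bar>)"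
    by (intro continuous_map_minus continuous_map_real_abs continuous_map_diff continuous_map_const[THEN iffD2]) auto
  \<comment> \<open>The maximum of the negated distance is the least distance of
    \<open>Re (g y)\<close> from \<open>c\<close> on \<open>B\<close>, positive because
    \<open>c\<close> is missed.\<close>
  then obtain x where x: "x \<in> B" "\<And>y. y \<in> B \<Longrightarrow> - \<bar>Re (g y) - c\<bar> \<le> - \<bar>Re (g x) - c\<bar>"
    using attains_max_on_closed[OF B(1), of "\<lambda>x. - \<bar>Re (g x) - c\<bar>"] g(2) by blast
  \<comment> \<open>With accuracy 1/20, \<open>e\<^sup>2 - e\<close> has modulus at most
    \<open>1/20 * 21/20 = 21/400\<close>, below 1/16.\<close>
  obtain e where e: "e \<in> A" "\<And>x. x \<in> B \<Longrightarrow> Re (g x) > c \<Longrightarrow> cmod (e x - 1) \<le> 1/20"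
    "\<And>x. x \<in> B \<Longrightarrow> Re (g x) < c \<Longrightarrow> cmod (e x) \<le> 1/20"
    by (rule approximate_idempotent[OF g(1), of "\<bar>Re (g x) - c\<bar>" c "1/20"]) (use x no in auto)
  have small: "cmod ((e b)\<^sup>2 - e b) \<le> 1/16" if b: "b \<in> B" for b
  proof -
    have "cmod (e b) \<le> 1/20 \<and> cmod (e b - 1) \<le> 21/20 \<or> cmod (e b) \<le> 21/20 \<and> cmod (e b - 1) \<le> 1/20"
      using e(2,3)[OF b] no b norm_triangle_ineq4[of "e b" 1] norm_triangle_ineq[of "e b - 1" 1]
      by (cases "Re (g b)" c rule: linorder_cases) auto
    then have "cmod (e b) * cmod (e b - 1) \<le> 21/400"
      using mult_mono[of "cmod (e b)" "1/20" "cmod (e b - 1)" "21/20"]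
        mult_mono[of "cmod (e b)" "21/20" "cmod (e b - 1)" "1/20"] by auto
    moreover have "(e b)\<^sup>2 - e b = e b * (e b - 1)" by (simp add: power2_eq_square algebra_simps)
    ultimately show ?thesis by (simp add: norm_mult)
  qed
  have "cmod ((e y)\<^sup>2 - e y) \<le> 1/16" if "y \<in> Y" for y
    using bdry[OF diff_closed[OF power_closed[OF e(1)] e(1)] that, of 2] small by force
  then show False
    using noidem[OF e(1), of b1 b2] e(2)[OF g(3,5)] e(3)[OF g(2,4)] g(2,3) B(2) by force
qed

text \<open>At each point at most one \<open>g j\<close> is bad, with error at most
  \<open>n\<close>; the others have error at most \<open>d - 1 / n\<close>. The total is at most
  \<open>n + n * n * (d - 1 / n) = n * n * d\<close>, less than
  \<open>(n * n + 1) * d\<close>.\<close>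

lemma average_approximation:
  fixes n :: nat
  assumes J: "finite J" "card J = n * n + 1" and n: "n > 0" and d: "d > 0"
    and disj: "\<And>i j z. i \<in> J \<Longrightarrow> j \<in> J \<Longrightarrow> z \<in> U i \<Longrightarrow> z \<in> U j \<Longrightarrow> i = j"
    and g: "\<And>j. j \<in> J \<Longrightarrow> g j \<in> A"
    and outside: "\<And>j z. j \<in> J \<Longrightarrow> z \<in> Y \<Longrightarrow> z \<notin> U j \<Longrightarrow> cmod (f z - g j z) \<le> d - 1 / n"
    and inside: "\<And>j z. j \<in> J \<Longrightarrow> z \<in> Y \<Longrightarrow> cmod (f z - g j z) \<le> n"
  shows "\<exists>h\<in>A. \<forall>z\<in>Y. cmod (f z - h z) < d"
proof (intro bexI ballI)
  define k where "k = real n * real n + 1"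
  have k: "k > 0" "real (card J) = k" using J(2) by (simp_all add: k_def add_nonneg_pos)
  let ?h = "\<lambda>z. of_real (1 / k) * (\<Sum>j\<in>J. g j z)"
  show "?h \<in> A" by (intro cmult_closed sum_closed J g)
  fix z assume z: "z \<in> Y"
  have "(\<Sum>j\<in>J. f z - g j z) = of_real k * f z - (\<Sum>j\<in>J. g j z)"
  proof -
    have "of_nat (card J) = (of_real k :: complex)" using k(2) by (metis of_real_of_nat_eq)
    then show ?thesis by (simp add: sum_subtractf)
  qed
  then have "f z - ?h z = of_real (1 / k) * (\<Sum>j\<in>J. f z - g j z)"
    using k(1) by (simp add: field_simps)
  then have "cmod (f z - ?h z) = (1 / k) * cmod (\<Sum>j\<in>J. f z - g j z)"
    using k(1) by (simp only: norm_mult norm_of_real) simp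
  also have "\<dots> \<le> (1 / k) * (\<Sum>j\<in>J. cmod (f z - g j z))"
    using k(1) by (intro mult_left_mono norm_sum) auto
  also have "(\<Sum>j\<in>J. cmod (f z - g j z)) < k * d"
  proof (cases "\<exists>j\<in>J. z \<in> U j")
    case True
    then obtain i where i: "i \<in> J" "z \<in> U i" by blast
    have "(\<Sum>j\<in>J. cmod (f z - g j z)) = cmod (f z - g i z) + (\<Sum>j\<in>J - {i}. cmod (f z - g j z))"
      using J(1) i(1) by (rule sum.remove)
    also have "\<dots> \<le> n + (\<Sum>j\<in>J - {i}. d - 1 / n)"
      using i disj by (intro add_mono sum_mono outside inside z) auto
    also have "(\<Sum>j\<in>J - {i}. d - 1 / n) = real n * real n * (d - 1 / n)"
      using J i(1) by simp
    also have "n + \<dots> = real n * real n * d" using n by (simp add: field_simps)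
    also have "\<dots> < k * d" using d by (simp add: k_def algebra_simps)
    finally show ?thesis .
  next
    case False
    then have "(\<Sum>j\<in>J. cmod (f z - g j z)) \<le> (\<Sum>j\<in>J. d - 1 / n)"
      by (intro sum_mono outside z) auto
    also have "\<dots> = k * (d - 1 / n)" using k(2) by simp
    also have "\<dots> < k * d" using k(1) n by (intro mult_strict_left_mono) auto
    finally show ?thesis .
  qed
  then have "(1 / k) * (\<Sum>j\<in>J. cmod (f z - g j z)) < (1 / k) * (k * d)"
    using k(1) by (intro mult_strict_left_mono) auto
  also have "\<dots> = d" using k(1) by simp
  finally show "cmod (f z - ?h z) < d" .
qed

end

section \<open>Products of ordered and scattered spaces\<close>

text \<open>An isolated point of the projection makes the slice of \<open>B\<close> over it
  relatively open in \<open>B\<close>.\<close>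

lemma scattered_image_isolated:
  assumes S: "scattered_space S" "B \<subseteq> topspace (prod_topology euclidean S)" "B \<noteq> {}"
  obtains \<sigma> G where "\<sigma> \<in> snd ` B" "openin S G" "G \<inter> snd ` B = {\<sigma>}"
proof -
  have "snd ` B \<subseteq> topspace S" "snd ` B \<noteq> {}" using S(2,3) by auto
  then obtain \<sigma> where "\<sigma> \<in> snd ` B" "openin (subtopology S (snd ` B)) {\<sigma>}"
    using S(1) unfolding scattered_space_def by meson
  then show ?thesis using that unfolding openin_subtopology by metis
qed

locale linear_times_scattered_algebra = compact_function_algebra A "prod_topology euclidean S"
  for A :: "('a::linorder_topology \<times> 'b \<Rightarrow> complex) set" and S :: "'b topology" +
  assumes Hausdorff: "Hausdorff_space S" and scattered: "scattered_space S"
    and separates: "x \<in> topspace (prod_topology euclidean S) \<Longrightarrow> y \<in> topspace (prod_topology euclidean S) \<Longrightarrow>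
      x \<noteq> y \<Longrightarrow> \<exists>g\<in>A. g x \<noteq> g y"
begin

abbreviation X where "X \<equiv> prod_topology (euclidean :: 'a topology) S"

lemma interpolation:
  assumes "x \<in> topspace X" "y \<in> topspace X" "x \<noteq> y"
  obtains g where "g \<in> A" "g x = 0" "g y = 1"
proof -
  obtain f where f: "f \<in> A" "f x \<noteq> f y" using separates[OF assms] by blast
  have "(\<lambda>z. (1 / (f y - f x)) * (f z - f x)) \<in> A" by (intro cmult_closed diff_closed const_closed f)
  then show ?thesis by (rule that) (use f(2) in auto)
qed

text \<open>Two points in \<open>B\<close> would lead to some \<open>F s - F t\<close> in
  \<open>A\<close> whose real part skips a value on \<open>B\<close>, against \<open>conn\<close>.
  The fibers carrying the \<open>F t\<close> come from the absence of a Cantor set.\<close>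

lemma singleton_if_minimal_boundary:
  fixes p :: "'a \<Rightarrow> real"
  assumes B: "closedin X B" "B \<noteq> {}"
    and conn: "\<And>g c b b'. g \<in> A \<Longrightarrow> b \<in> B \<Longrightarrow> b' \<in> B \<Longrightarrow> Re (g b) < c \<Longrightarrow> c < Re (g b') \<Longrightarrow>
      \<exists>b''\<in>B. Re (g b'') = c"
    and min: "\<And>W. closedin X W \<Longrightarrow> W \<subset> B \<Longrightarrow> \<exists>g\<in>A. \<exists>b\<in>B. \<forall>w\<in>W. cmod (g w) < cmod (g b)"
    and p: "mono p" "continuous_on UNIV p" "\<And>t. finite (fst ` B \<inter> p -` {t})"
    and noCantor: "\<nexists>K. Cantor_subset_of (euclidean :: 'a topology) K"
  shows "\<exists>b. B = {b}"
proof (rule ccontr)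
  assume notsing: "\<nexists>b. B = {b}"
  have BX: "B \<subseteq> topspace X" using B(1) by (rule closedin_subset)
  obtain \<sigma> G where \<sigma>: "\<sigma> \<in> snd ` B" and G: "openin S G" "G \<inter> snd ` B = {\<sigma>}"
    using scattered_image_isolated[OF scattered BX B(2)] by blast
  have \<sigma>S: "\<sigma> \<in> topspace S" using \<sigma> BX by auto
  define W where "W = B - UNIV \<times> G"
  have "openin X (UNIV \<times> G)" using G(1) by (simp add: openin_prod_Times_iff)
  then have W: "closedin X W" unfolding W_def using B(1) by (intro closedin_diff)
  have W_iff: "b \<in> W \<longleftrightarrow> snd b \<noteq> \<sigma>" if "b \<in> B" for b
  proof -
    have "snd b \<in> G \<longleftrightarrow> snd b = \<sigma>" using that G(2) by blast
    then show ?thesis using that by (simp add: W_def mem_Times_iff)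
  qed
  have WB: "W \<subseteq> B" by (auto simp: W_def)
  define U where "U = {x. (x, \<sigma>) \<in> B}"
  have "compact U"
  proof -
    have "closedin X (B \<inter> UNIV \<times> {\<sigma>})"
      using B(1) Hausdorff \<sigma>S
      by (intro closedin_Int) (auto simp: closedin_prod_Times_iff closedin_Hausdorff_singleton)
    then have "compactin X (B \<inter> UNIV \<times> {\<sigma>})" using compact closedin_compact_space by blast
    then have "compactin euclidean (fst ` (B \<inter> UNIV \<times> {\<sigma>}))"
      by (rule image_compactin) (rule continuous_map_fst)
    moreover have "fst ` (B \<inter> UNIV \<times> {\<sigma>}) = U" by (force simp: U_def)
    ultimately show ?thesis by simp
  qed
  have contU: "continuous_on U (\<lambda>x. g (x, \<sigma>))" if "g \<in> A" for g
  proof -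
    have "continuous_map euclidean X (\<lambda>x. (x, \<sigma>))"
      using \<sigma>S by (simp add: continuous_map_pairedI)
    then have "continuous_map euclidean euclidean (g \<circ> (\<lambda>x. (x, \<sigma>)))"
      using continuous[OF that] by (rule continuous_map_compose)
    then have "continuous_on UNIV (\<lambda>x. g (x, \<sigma>))" by (simp add: o_def)
    then show ?thesis by (rule continuous_on_subset) simp
  qed
  have finU: "finite (U \<inter> p -` {t})" for t
    by (rule finite_subset[OF _ p(3)[of t]]) (force simp: U_def)
  \<comment> \<open>If the slice is all of \<open>B\<close>, interpolation between two points works
    with \<open>r = 1/2\<close>. Otherwise minimality gives \<open>g\<close> larger at some
    \<open>b\<close> than anywhere on \<open>W\<close>; dividing by \<open>g b\<close> makes
    \<open>h b = 1\<close>, and \<open>r < 1\<close> is the maximum modulus on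
    \<open>W\<close>.\<close>
  have "\<exists>h\<in>A. \<exists>r\<ge>0. \<exists>b0\<in>B. \<exists>b1\<in>B. (\<forall>w\<in>W. cmod (h w) \<le> r) \<and> Re (h b0) \<le> r \<and> r < Re (h b1)"
  proof (cases "W = {}")
    case True
    obtain b where b: "b \<in> B" using B(2) by blast
    then obtain b' where b': "b' \<in> B" "b' \<noteq> b" using notsing by blast
    obtain h where h: "h \<in> A" "h b = 0" "h b' = 1"
      using interpolation[of b b'] BX b b' by blast
    then have "Re (h b) \<le> 1/2" "1/2 < Re (h b')" "(0::real) \<le> 1/2" "\<forall>w\<in>W. cmod (h w) \<le> 1/2"
      using True by simp_all
    then show ?thesis using h(1) b b'(1) by blast
  next
    case False
    have "W \<subset> B" using WB W_iff \<sigma> by blast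
    then obtain g b where g: "g \<in> A" "b \<in> B" "\<And>w. w \<in> W \<Longrightarrow> cmod (g w) < cmod (g b)"
      using min[OF W] by blast
    obtain w where w: "w \<in> W" "\<And>w'. w' \<in> W \<Longrightarrow> cmod (g w') \<le> cmod (g w)"
      using attains_max_on_closed[OF W False continuous_map_cmod[OF g(1)]] by blast
    have pos: "cmod (g b) > 0" using g(3)[OF w(1)] norm_ge_zero[of "g w"] by linarith
    define h where "h z = (1 / g b) * g z" for z
    define r where "r = cmod (g w) / cmod (g b)"
    have "h \<in> A" unfolding h_def by (intro cmult_closed g)
    moreover have "\<forall>w'\<in>W. cmod (h w') \<le> r"
      using w(2) pos by (auto simp: h_def r_def norm_mult norm_divide divide_right_mono)
    moreover have "Re (h w) \<le> r"
      using complex_Re_le_cmod[of "h w"] by (simp add: h_def r_def norm_mult norm_divide)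
    moreover have "r < Re (h b)" using g(3)[OF w(1)] pos by (simp add: h_def r_def)
    moreover have "r \<ge> 0" by (simp add: r_def)
    ultimately show ?thesis using w(1) WB g(2) by blast
  qed
  then obtain h r b0 b1 where h: "h \<in> A" and r: "r \<ge> 0" and b01: "b0 \<in> B" "b1 \<in> B"
    and hW: "\<And>w. w \<in> W \<Longrightarrow> cmod (h w) \<le> r" and hb: "Re (h b0) \<le> r" "r < Re (h b1)" by blast
  define T where "T = {t. \<exists>x\<in>U. \<exists>y\<in>U. x < y \<and> p x = t \<and> p y = t \<and>
    r < cmod (h (Max (U \<inter> p -` {t}), \<sigma>))}"
  \<comment> \<open>\<open>conn\<close> supplies the value somewhere on \<open>B\<close>, and it
    exceeds \<open>r\<close>, so the point lies on the slice.\<close>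
  have "\<exists>x\<in>U. Re (h (x, \<sigma>)) = c" if c: "r < c" "c < Re (h b1)" for c
  proof -
    obtain b where b: "b \<in> B" "Re (h b) = c" using conn[OF h b01, of c] c hb by auto
    then have "b \<notin> W" using hW[of b] c(1) complex_Re_le_cmod[of "h b"] by fastforce
    then have "b = (fst b, \<sigma>)" using W_iff[OF b(1)] by (metis prod.collapse)
    then show ?thesis using b by (metis U_def mem_Collect_eq)
  qed
  then have "uncountable T"
    unfolding T_def
    by (intro uncountable_nontrivial_fibers[OF p(1,2) \<open>compact U\<close> finU contU[OF h] hb(2) _ noCantor])
  have fiber: "Min (U \<inter> p -` {t}) \<in> U" "Max (U \<inter> p -` {t}) \<in> U"
    "Min (U \<inter> p -` {t}) < Max (U \<inter> p -` {t})" "U \<inter> p -` {t} \<noteq> {}" "r < cmod (h (Max (U \<inter> p -` {t}), \<sigma>))"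
    if t: "t \<in> T" for t
  proof -
    obtain x y where "x \<in> U" "p x = t" "y \<in> U" "p y = t" "x < y"
      and r': "r < cmod (h (Max (U \<inter> p -` {t}), \<sigma>))" using t unfolding T_def by blast
    then have xy: "x \<in> U \<inter> p -` {t}" "y \<in> U \<inter> p -` {t}" "x < y" by simp_all
    then show "U \<inter> p -` {t} \<noteq> {}" "r < cmod (h (Max (U \<inter> p -` {t}), \<sigma>))" using r' by auto
    then show "Min (U \<inter> p -` {t}) \<in> U" "Max (U \<inter> p -` {t}) \<in> U"
      using Min_in[OF finU] Max_in[OF finU] by blast+
    show "Min (U \<inter> p -` {t}) < Max (U \<inter> p -` {t})"
      using Min_le[OF finU xy(1)] Max_ge[OF finU xy(2)] xy(3) by order
  qed
  have "\<exists>F\<in>A. F (Min (U \<inter> p -` {t}), \<sigma>) = 0 \<and> F (Max (U \<inter> p -` {t}), \<sigma>) = 1 \<and> (\<forall>w\<in>W. cmod (F w) \<le> 1/8)"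
    if t: "t \<in> T" for t
  proof -
    let ?a = "(Min (U \<inter> p -` {t}), \<sigma>)" and ?b = "(Max (U \<inter> p -` {t}), \<sigma>)"
    have "?a \<in> topspace X" "?b \<in> topspace X" "?a \<noteq> ?b" using fiber[OF t] \<sigma>S by auto
    then obtain f where f: "f \<in> A" "f ?a = 0" "f ?b = 1" using interpolation by blast
    obtain R where R: "R > 0" "\<And>w. w \<in> W \<Longrightarrow> cmod (f w) \<le> R"
      using bounded_on_closed[OF W continuous_map_cmod[OF f(1)]] by blast
    define q where "q = r / cmod (h ?b)"
    have nz: "cmod (h ?b) > 0" using fiber(5)[OF t] r by linarith
    have q: "0 \<le> q" "q < 1" using r fiber(5)[OF t] nz by (simp_all add: q_def)
    obtain n where n: "q ^ n < 1 / (8 * R)" using real_arch_pow_inv[of "1 / (8 * R)" q] q R(1) by auto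
    \<comment> \<open>The power of \<open>h\<close>, normalised at the right end, leaves the values
      0 and 1 at the ends unchanged and shrinks like \<open>q ^ n\<close> on
      \<open>W\<close>.\<close>
    define F where "F z = f z * ((1 / h ?b) * h z) ^ n" for z
    have "F \<in> A" unfolding F_def by (intro mult_closed power_closed const_closed f h)
    moreover have "F ?a = 0" "F ?b = 1" using f nz by (auto simp: F_def)
    moreover have "cmod (F w) \<le> 1/8" if w: "w \<in> W" for w
    proof -
      have "cmod ((1 / h ?b) * h w) \<le> q"
        using hW[OF w] nz by (simp add: q_def norm_mult norm_divide divide_right_mono)
      then have "cmod (F w) \<le> R * q ^ n"
        unfolding F_def norm_mult[of "f w"] norm_power
        using R(1) R(2)[OF w] by (intro mult_mono power_mono) auto
      also have "\<dots> \<le> R * (1 / (8 * R))" using n R(1) by (intro mult_left_mono) auto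
      also have "\<dots> = 1/8" using R(1) by simp
      finally show ?thesis .
    qed
    ultimately show ?thesis by blast
  qed
  then obtain F where F: "\<And>t. t \<in> T \<Longrightarrow> F t \<in> A" "\<And>t. t \<in> T \<Longrightarrow> F t (Min (U \<inter> p -` {t}), \<sigma>) = 0"
    "\<And>t. t \<in> T \<Longrightarrow> F t (Max (U \<inter> p -` {t}), \<sigma>) = 1"
    "\<And>t w. t \<in> T \<Longrightarrow> w \<in> W \<Longrightarrow> cmod (F t w) \<le> 1/8" by metis
  obtain s t c where st: "s \<in> T" "t \<in> T" "1/2 < c" and ne: "\<And>x. x \<in> U \<Longrightarrow> Re (F s (x, \<sigma>) - F t (x, \<sigma>)) \<noteq> c"
    and sides: "\<exists>x\<in>U. Re (F s (x, \<sigma>) - F t (x, \<sigma>)) < c" "\<exists>x\<in>U. Re (F s (x, \<sigma>) - F t (x, \<sigma>)) > c"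
    by (rule exists_disconnected_difference[OF p(1,2) \<open>compact U\<close> finU \<open>uncountable T\<close>,
        where F = "\<lambda>t x. F t (x, \<sigma>)"]) (use fiber(4) contU F in auto)
  let ?g = "\<lambda>z. F s z - F t z"
  have "?g \<in> A" using F(1) st by (intro diff_closed)
  obtain x y where xy: "(x, \<sigma>) \<in> B" "(y, \<sigma>) \<in> B" "Re (?g (x, \<sigma>)) < c" "c < Re (?g (y, \<sigma>))"
    using sides by (auto simp: U_def)
  \<comment> \<open>The value \<open>c > 1/2\<close> can be taken neither off the slice, where both
    functions are at most 1/8 in modulus, nor on it, by \<open>ne\<close>.\<close>
  obtain b where b: "b \<in> B" "Re (?g b) = c" using conn[OF \<open>?g \<in> A\<close> xy] by blast
  show False
  proof (cases "b \<in> W")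
    case True
    then have "cmod (?g b) \<le> 1/4"
      using norm_triangle_ineq4[of "F s b" "F t b"] F(4)[OF st(1) True] F(4)[OF st(2) True] by linarith
    then show False using complex_Re_le_cmod[of "?g b"] b(2) st(3) by linarith
  next
    case False
    then have "b = (fst b, \<sigma>)" using W_iff[OF b(1)] by (metis prod.collapse)
    then show False using ne[of "fst b"] b unfolding U_def by (metis mem_Collect_eq)
  qed
qed

text \<open>If all of \<open>A\<close> had error at least \<open>d\<close>, a minimal set
  \<open>Y\<close> would carry this error; a one-point boundary then shrinks \<open>Y\<close> to a
  point, where a constant matches \<open>f\<close>.\<close>

lemma approximable:
  assumes f: "continuous_map X euclidean f" and d: "d > 0"
    and noCantor: "\<nexists>K. Cantor_subset_of (euclidean :: 'a topology) K"
    and cL: "compact (UNIV :: 'a set)"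
  shows "\<exists>g\<in>A. \<forall>x\<in>topspace X. cmod (f x - g x) < d"
proof (rule ccontr)
  assume "\<not> ?thesis"
  then have farX: "\<exists>x\<in>topspace X. d \<le> cmod (f x - g x)" if "g \<in> A" for g
    using that by (meson not_le)
  \<comment> \<open>A closed set meets every \<open>Z g\<close> with \<open>g\<close> in
    \<open>A\<close> exactly when each element of \<open>A\<close> still has error at least
    \<open>d\<close> somewhere on it.\<close>
  define Z where "Z g = {x \<in> topspace X. d \<le> cmod (f x - g x)}" for g
  have clo_ge: "closedin X {x \<in> topspace X. e \<le> k x}" if "continuous_map X euclideanreal k" for e k
  proof -
    have "closedin X {x \<in> topspace X. k x \<in> {e..}}"
      by (rule closedin_continuous_map_preimage[OF that]) simp
    then show ?thesis by simp
  qed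
  obtain Y where Y: "closedin X Y" and YZ: "\<And>S. S \<in> Z ` A \<Longrightarrow> Y \<inter> S \<noteq> {}"
    and Ymin: "\<And>W. closedin X W \<Longrightarrow> W \<subset> Y \<Longrightarrow> \<exists>S\<in>Z ` A. W \<inter> S = {}"
  proof (rule minimal_closed_transversal[OF compact, of "Z ` A" "topspace X"])
    show "closedin X S" if "S \<in> Z ` A" for S
      using that clo_ge[OF continuous_map_cmod_diff[OF f]] by (auto simp: Z_def)
    show "topspace X \<inter> S \<noteq> {}" if "S \<in> Z ` A" for S
      using that farX by (fastforce simp: Z_def)
  qed (rule that closedin_topspace; assumption)+
  have YX: "Y \<subseteq> topspace X" using Y by (rule closedin_subset)
  have far: "\<exists>y\<in>Y. d \<le> cmod (f y - g y)" if "g \<in> A" for g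
    using YZ[of "Z g"] that by (auto simp: Z_def)
  have near: "\<exists>g\<in>A. \<forall>y\<in>W. cmod (f y - g y) < d" if W: "closedin X W" "W \<subset> Y" for W
  proof -
    obtain g where "g \<in> A" "W \<inter> Z g = {}" using Ymin[OF W] by blast
    moreover have "cmod (f y - g y) < d" if "y \<in> W" for y
    proof -
      have "y \<in> topspace X" "y \<notin> Z g" using that W(2) YX \<open>W \<inter> Z g = {}\<close> by blast+
      then show ?thesis by (simp add: Z_def not_le)
    qed
    ultimately show ?thesis by blast
  qed
  \<comment> \<open>Intervals such that some element of \<open>A\<close> gains a margin over
    \<open>d\<close> outside the strip and has bounded error on \<open>Y\<close>. Too many disjoint
    ones would average to an error below \<open>d\<close> on all of \<open>Y\<close>.\<close>
  define I where "I n = {q. fst q < snd q \<and> (\<exists>g\<in>A. \<forall>z\<in>Y.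
    (fst z \<notin> {fst q<..<snd q} \<longrightarrow> cmod (f z - g z) \<le> d - 1 / real (Suc n)) \<and> cmod (f z - g z) \<le> real (Suc n))}" for n
  have "\<exists>C. finite C \<and> (\<forall>q\<in>I n. \<exists>c\<in>C. fst q \<le> c \<and> c \<le> snd q)" for n
  proof (rule finite_piercing[OF cL, where k = "Suc n * Suc n + 1"])
    show "fst q < snd q" if "q \<in> I n" for q using that by (simp add: I_def)
    fix J assume J: "J \<subseteq> I n" "finite J" "pairwise (\<lambda>q r. snd q \<le> fst r \<or> snd r \<le> fst q) J"
    show "card J \<noteq> Suc n * Suc n + 1"
    proof
      assume card: "card J = Suc n * Suc n + 1"
      have "\<forall>q\<in>J. \<exists>g. g \<in> A \<and> (\<forall>z\<in>Y.
        (fst z \<notin> {fst q<..<snd q} \<longrightarrow> cmod (f z - g z) \<le> d - 1 / real (Suc n)) \<and> cmod (f z - g z) \<le> real (Suc n))"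
        using J(1) by (auto simp: I_def)
      then obtain g where g: "\<forall>q\<in>J. g q \<in> A \<and> (\<forall>z\<in>Y.
        (fst z \<notin> {fst q<..<snd q} \<longrightarrow> cmod (f z - g q z) \<le> d - 1 / real (Suc n)) \<and> cmod (f z - g q z) \<le> real (Suc n))"
        by (rule bchoice[THEN exE])
      have "\<exists>h\<in>A. \<forall>z\<in>Y. cmod (f z - h z) < d"
      proof (rule average_approximation[OF J(2) card _ d, where g = g and U = "\<lambda>q. {z. fst z \<in> {fst q<..<snd q}}"])
        fix i j z assume *: "i \<in> J" "j \<in> J" "z \<in> {z. fst z \<in> {fst i<..<snd i}}" "z \<in> {z. fst z \<in> {fst j<..<snd j}}"
        show "i = j"
        proof (rule ccontr)
          assume "i \<noteq> j"
          then have "snd i \<le> fst j \<or> snd j \<le> fst i" using J(3) *(1,2) by (simp add: pairwise_def)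
          then show False using *(3,4) by auto
        qed
      qed (use g in auto)
      then show False using far by fastforce
    qed
  qed
  then obtain C where C: "\<And>n. finite (C n)" "\<And>n q. q \<in> I n \<Longrightarrow> \<exists>c\<in>C n. fst q \<le> c \<and> c \<le> snd q" by metis
  \<comment> \<open>Removing the strip over \<open>{x<..<y}\<close> leaves a proper closed subset of
    \<open>Y\<close>, approximable with a margin, so the interval belongs to some
    \<open>I n\<close>.\<close>
  have pierce: "\<exists>c\<in>\<Union>(range C). x \<le> c \<and> c \<le> y" if xyz: "z \<in> fst ` Y" "x < z" "z < y" for x y z
  proof -
    define W where "W = Y - {x<..<y} \<times> topspace S"
    have "openin X ({x<..<y} \<times> topspace S)" by (simp add: openin_prod_Times_iff)
    then have W: "closedin X W" unfolding W_def using Y by (intro closedin_diff)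
    have "W \<subset> Y" using xyz YX by (fastforce simp: W_def)
    then obtain g where g: "g \<in> A" "\<And>w. w \<in> W \<Longrightarrow> cmod (f w - g w) < d" using near[OF W] by blast
    obtain d' where d': "d' < d" "\<And>w. w \<in> W \<Longrightarrow> cmod (f w - g w) \<le> d'"
      using strict_bound_on_closed[OF W continuous_map_cmod_diff[OF f g(1)] g(2)] by blast
    obtain M where M: "\<And>w. w \<in> Y \<Longrightarrow> cmod (f w - g w) \<le> M"
      using bounded_on_closed[OF Y continuous_map_cmod_diff[OF f g(1)]] by blast
    obtain n where n: "max M (1 / (d - d')) < real n" using reals_Archimedean2 by blast
    have "1 / real (Suc n) \<le> d - d'"
    proof -
      have "1 / (d - d') < real (Suc n)" using n by simp
      then show ?thesis using d'(1) by (simp add: field_simps)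
    qed
    then have "cmod (f w - g w) \<le> d - 1 / real (Suc n)" if "w \<in> W" for w
      using d'(2)[OF that] by linarith
    moreover have "cmod (f w - g w) \<le> real (Suc n)" if "w \<in> Y" for w using M[OF that] n by simp
    moreover have "w \<in> W" if "w \<in> Y" "fst w \<notin> {x<..<y}" for w using that by (auto simp: W_def)
    ultimately have "(x, y) \<in> I n"
      unfolding I_def using g(1) xyz by (auto intro!: bexI[of _ g])
    then show ?thesis using C(2)[of "(x,y)" n] by auto
  qed
  have "countable (\<Union>(range C))" using C(1) by (auto intro: countable_finite)
  then obtain p :: "'a \<Rightarrow> real" where p: "continuous_on UNIV p" "mono p"
    "\<And>c d. c \<in> \<Union>(range C) \<Longrightarrow> d \<in> \<Union>(range C) \<Longrightarrow> c < d \<Longrightarrow> p c < p d"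
    using monotone_separating_countable[OF cL] by metis
  have fin: "finite (fst ` Y \<inter> p -` {t})" for t
    by (rule finite_fibers_if_pierced[OF p(2), of "\<Union>(range C)"]) (fact p(3), fact pierce)
  \<comment> \<open>Meeting all these sets means being a boundary of \<open>Y\<close>: the modulus
    of each \<open>g\<close> in \<open>A\<close> reaches on it at least its value at every point of
    \<open>Y\<close>.\<close>
  define Z' where "Z' = (\<lambda>(g, y). {x \<in> topspace X. cmod (g y) \<le> cmod (g x)})"
  obtain B where B: "closedin X B" "B \<subseteq> Y" and BZ: "\<And>S. S \<in> Z' ` (A \<times> Y) \<Longrightarrow> B \<inter> S \<noteq> {}"
    and Bmin: "\<And>W. closedin X W \<Longrightarrow> W \<subset> B \<Longrightarrow> \<exists>S\<in>Z' ` (A \<times> Y). W \<inter> S = {}"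
  proof (rule minimal_closed_transversal[OF compact _ Y, of "Z' ` (A \<times> Y)"])
    show "closedin X S" if "S \<in> Z' ` (A \<times> Y)" for S
      using that clo_ge[OF continuous_map_cmod] by (auto simp: Z'_def)
    show "Y \<inter> S \<noteq> {}" if "S \<in> Z' ` (A \<times> Y)" for S
      using that YX by (auto simp: Z'_def)
  qed (rule that; assumption)
  have BX: "B \<subseteq> topspace X" using B(1) by (rule closedin_subset)
  have bdry: "\<exists>b\<in>B. cmod (g y) \<le> cmod (g b)" if "g \<in> A" "y \<in> Y" for g y
    using BZ[of "Z' (g, y)"] that by (auto simp: Z'_def)
  have "\<exists>b. B = {b}"
  proof (rule singleton_if_minimal_boundary[OF B(1) _ _ _ p(2,1) _ noCantor])
    obtain y where "y \<in> Y" using far[OF const_closed] by blast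
    then show "B \<noteq> {}" using bdry[OF const_closed] by blast
    show "finite (fst ` B \<inter> p -` {t})" for t
      by (rule finite_subset[OF _ fin[of t]]) (use B(2) in auto)
    show "\<exists>b''\<in>B. Re (g b'') = c" if "g \<in> A" "b \<in> B" "b' \<in> B" "Re (g b) < c" "c < Re (g b')" for g c b b'
      using Y B bdry no_approximate_idempotent[OF f Y far near] that by (rule connected_Re_of_boundary)
    show "\<exists>g\<in>A. \<exists>b\<in>B. \<forall>w\<in>W. cmod (g w) < cmod (g b)" if W: "closedin X W" "W \<subset> B" for W
    proof -
      obtain g y where g: "g \<in> A" "y \<in> Y" "W \<inter> Z' (g, y) = {}" using Bmin[OF W] by blast
      obtain b where b: "b \<in> B" "cmod (g y) \<le> cmod (g b)" using bdry[OF g(1,2)] by blast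
      have "cmod (g w) < cmod (g b)" if "w \<in> W" for w
        using g(3) that W(2) BX b(2) by (force simp: Z'_def)
      then show ?thesis using g(1) b(1) by blast
    qed
  qed
  then obtain b where b: "B = {b}" by blast
  \<comment> \<open>\<open>g - g b\<close> vanishes on the boundary \<open>{b}\<close>, hence on
    \<open>Y\<close>.\<close>
  have eq: "g y = g b" if "g \<in> A" "y \<in> Y" for g y
    using bdry[OF diff_closed[OF that(1) const_closed] that(2), of "g b"] b by simp
  have "Y \<subseteq> {b}"
  proof
    fix y assume "y \<in> Y"
    then have "y \<in> topspace X" "b \<in> topspace X" using YX BX b by blast+
    then show "y \<in> {b}" using separates[of y b] eq[OF _ \<open>y \<in> Y\<close>] by blast
  qed
  then show False using far[OF const_closed[of "f b"]] d by auto
qed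

end

section \<open>Density in the space of continuous functions\<close>

theorem theorem1p3:
  fixes L :: "'a :: linorder_topology topology" and S :: "'b topology"
  assumes "L = euclidean"
    and "compact_space L"
    and "\<nexists>K. Cantor_subset_of L K"
    and "compact_space S" and "Hausdorff_space S" and "scattered_space S"
  shows "CSWP (prod_topology L S)"
  unfolding CSWP_def
proof (intro conjI allI impI)
  let ?X = "prod_topology L S"
  show "compact_space ?X" using assms by (simp add: compact_space_prod_topology)
  show "Hausdorff_space ?X"
    using assms Hausdorff_space_euclidean_t2 by (auto simp: Hausdorff_space_prod_topology)
  fix A0 assume A0: "complex_subalgebra ?X A0 \<and> separates_points ?X A0 \<and> contains_constants ?X A0"
  \<comment> \<open>Elements of \<open>A0\<close> are extensional. Passing to all total functions
    that restrict to them makes the algebra operations plain pointwise ones.\<close>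
  define A where "A = {g. restrict g (topspace ?X) \<in> A0}"
  have sub: "A0 \<subseteq> mspace (C_metric ?X)" using A0 by (simp add: complex_subalgebra_def)
  interpret linear_times_scattered_algebra A S
  proof
    fix f g assume "f \<in> A" "g \<in> A"
    then have fg: "restrict f (topspace ?X) \<in> A0" "restrict g (topspace ?X) \<in> A0" by (simp_all add: A_def)
    have "(\<lambda>x\<in>topspace ?X. restrict f (topspace ?X) x + restrict g (topspace ?X) x) \<in> A0"
      using A0 fg unfolding complex_subalgebra_def by blast
    then show "(\<lambda>x. f x + g x) \<in> A" by (simp add: A_def cong: restrict_cong)
    have "(\<lambda>x\<in>topspace ?X. restrict f (topspace ?X) x * restrict g (topspace ?X) x) \<in> A0"
      using A0 fg unfolding complex_subalgebra_def by blast
    then show "(\<lambda>x. f x * g x) \<in> A" by (simp add: A_def cong: restrict_cong)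
  next
    show "(\<lambda>_. c) \<in> A" for c using A0 by (simp add: A_def contains_constants_def)
    show "compact_space (prod_topology (euclidean :: 'a topology) S)" using assms by (simp add: compact_space_prod_topology)
    show "continuous_map (prod_topology (euclidean :: 'a topology) S) euclidean g" if "g \<in> A" for g
    proof -
      have "restrict g (topspace ?X) \<in> mspace (C_metric ?X)" using that sub by (auto simp: A_def)
      then have "continuous_map ?X euclidean (restrict g (topspace ?X))" by simp
      then have "continuous_map ?X euclidean g" by (rule continuous_map_eq) simp
      then show ?thesis using assms(1) by simp
    qed
    show "\<exists>g\<in>A. g x \<noteq> g y"
      if xy: "x \<in> topspace (prod_topology (euclidean :: 'a topology) S)" "y \<in> topspace (prod_topology (euclidean :: 'a topology) S)" "x \<noteq> y" for x y
    proof -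
      obtain g where g: "g \<in> A0" "g x \<noteq> g y"
        using A0 xy unfolding separates_points_def assms(1) by blast
      have "g \<in> extensional (topspace ?X)" using g(1) sub by auto
      then have "restrict g (topspace ?X) = g" by (rule extensional_restrict)
      then have "g \<in> A" using g(1) by (simp only: A_def mem_Collect_eq)
      then show ?thesis using g(2) by blast
    qed
  qed (use assms in auto)
  have cL: "compact (UNIV :: 'a set)" using assms(1,2) by (simp add: compact_space_def)
  show "mtopology_of (C_metric ?X) closure_of A0 = mspace (C_metric ?X)"
  proof (intro equalityI subsetI)
    show "f \<in> mspace (C_metric ?X)" if "f \<in> mtopology_of (C_metric ?X) closure_of A0" for f
      using subsetD[OF closure_of_subset_topspace that] by simp
    fix f assume f: "f \<in> mspace (C_metric ?X)"
    have "\<exists>g\<in>A0. g \<in> mspace (C_metric ?X) \<and> mdist (C_metric ?X) f g < r" if "r > 0" for r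
    proof -
      have "continuous_map ?X euclidean f" using f by simp
      \<comment> \<open>Pointwise bounds give only a weak inequality for the supremum, so
        \<open>r/2\<close> is used to stay strictly below \<open>r\<close>.\<close>
      then obtain g where g: "g \<in> A" "\<And>x. x \<in> topspace ?X \<Longrightarrow> cmod (f x - g x) < r/2"
        using approximable[of f "r/2"] assms(1,3) cL \<open>r > 0\<close> by auto
      let ?g = "restrict g (topspace ?X)"
      have gA: "?g \<in> A0" using g(1) by (simp add: A_def)
      then have "mdist (C_metric ?X) f ?g \<le> r/2"
        using g(2) \<open>r > 0\<close> sub f by (intro mdist_cfunspace_le) (auto simp: dist_norm less_imp_le)
      then show ?thesis using gA sub \<open>r > 0\<close> by (intro bexI[of _ ?g]) auto
    qed
    then show "f \<in> mtopology_of (C_metric ?X) closure_of A0"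
      using f unfolding mtopology_of_def Metric_space.metric_closure_of[OF Metric_space_mspace_mdist]
        mem_Collect_eq Metric_space.in_mball[OF Metric_space_mspace_mdist] by blast
  qed
qed

end
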